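(* Let $S$ be a subset of $\mathrm{SL}(2,5)$ such that $1\in S$, $S=S^{-1}$, $\langle S\rangle=\mathrm{SL}(2,5)$ and $S^3\ne\mathrm{SL}(2,5)$. Then $|S^3|\ge|S|^{1.3925}$, and the set $S$ closest to this bound (that is, minimising $\log|S^3|/\log|S|$ among all such sets) has size $30$ with $|S^3|=114$.
   Context: For a subset $S$ of a group, $S^3=\{abc: a,b,c\in S\}$ and $S^{-1}=\{s^{-1}:s\in S\}$. *)

theory Defs
  imports "HOL-Analysis.Determinants" "HOL-Algebra.Generated_Groups"
begin

definition SL :: "('a::comm_ring_1^'n^'n) monoid"
  where "SL = \<lparr>carrier = {A. det A = 1}, monoid.mult = (**), one = mat 1\<rparr>"

(* The ring of coefficients is the numeral type 5, i.e. the integers modulo 5. *)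
abbreviation SL25 :: "(5^2^2) monoid"
  where "SL25 \<equiv> SL"

definition cube :: "('g, 'b) monoid_scheme \<Rightarrow> 'g set \<Rightarrow> 'g set"
  where "cube G S = S <#>\<^bsub>G\<^esub> S <#>\<^bsub>G\<^esub> S"

definition admissible :: "('g, 'b) monoid_scheme \<Rightarrow> 'g set \<Rightarrow> bool"
  where "admissible G S \<longleftrightarrow>
    S \<subseteq> carrier G \<and> \<one>\<^bsub>G\<^esub> \<in> S \<and> S = set_inv\<^bsub>G\<^esub> S \<and>
    generate G S = carrier G \<and> cube G S \<noteq> carrier G"

definition growth_exponent :: "('g, 'b) monoid_scheme \<Rightarrow> 'g set \<Rightarrow> real"
  where "growth_exponent G S = ln (real (card (cube G S))) / ln (real (card S))"

lemma cube_eq: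
  "cube G S = {a \<otimes>\<^bsub>G\<^esub> b \<otimes>\<^bsub>G\<^esub> c | a b c. a \<in> S \<and> b \<in> S \<and> c \<in> S}"
  by (auto simp: cube_def set_mult_def)

(* Since SL25 is a group, inv and generate (used in admissible) have their
   usual meaning. *)
lemma group_SL2: "group (SL :: ('a::comm_ring_1^2^2) monoid)"
proof (rule groupI)
  fix A :: "'a^2^2" assume A: "A \<in> carrier SL"
  define B :: "'a^2^2" where
    "B = (\<chi> i j. if i = 1 then (if j = 1 then A$2$2 else - A$1$2)
                   else (if j = 1 then - A$2$1 else A$1$1))"
  have d: "A$1$1 * A$2$2 - A$1$2 * A$2$1 = 1"
    using A by (simp add: SL_def det_2)
  have B: "B$1$1 = A$2$2" "B$1$2 = - A$1$2" "B$2$1 = - A$2$1" "B$2$2 = A$1$1"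
    by (simp_all add: B_def)
  have "det B = 1"
    using d by (simp add: det_2 B algebra_simps)
  moreover have "B ** A = mat 1"
    using d by (simp add: vec_eq_iff forall_2 matrix_matrix_mult_def sum_2 mat_def B algebra_simps)
  ultimately show "\<exists>B\<in>carrier SL. B \<otimes>\<^bsub>SL\<^esub> A = \<one>\<^bsub>SL\<^esub>"
    by (auto simp: SL_def)
qed (auto simp: SL_def det_mul matrix_mul_assoc)

end

theory Submission
  imports Defs
begin

text \<open>
  The group has \<open>120\<close> elements. Let \<open>S\<close> be an admissible set, let \<open>T\<close> be \<open>S\<close> without its central
  elements, and let \<open>h\<close> be the number of inverse pairs \<open>{x, x\<^sup>-\<^sup>1}\<close> in \<open>T\<close>, so that \<open>S\<close> has at most
  \<open>2 * h + 2\<close> elements. Put \<open>c = ln 114 / ln 30\<close>, which is slightly more than \<open>1.3925\<close>. Everything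
  follows once the cube of \<open>{1} \<union> T\<close> is known to have at least \<open>(2 * h + 2) powr c\<close> elements, read
  as all \<open>120\<close> elements when \<open>h \<ge> 15\<close>: rounding the powers up to integers leaves a single case of
  equality, \<open>h = 14\<close>, and equality there forces \<open>card S = 30\<close> and a cube with \<open>114\<close> elements. A
  set \<open>T\<close> that violates the bound is called slow, and \<open>not_slow\<close> says that there is none. An explicit
  set of size \<open>30\<close> attains the bound.

  Slow sets are excluded by two searches, both up to conjugation by \<open>GL(2,5)\<close>. Once no slow set
  contains \<open>x\<close>, none contains a conjugate of \<open>x\<close>, and all conjugates can be struck out together
  (\<open>dead_sweep\<close>).

  When \<open>h \<le> 11\<close>, a slow set has a cube with fewer than \<open>84\<close> elements. Cubes of generating sets grow
  much faster than that: the set is built up pair by pair, first by elements outside a proper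
  subgroup that contains the part chosen so far, and soon every further pair makes the cube too
  large (\<open>explore_sound\<close>, \<open>kills_dead\<close>).

  When \<open>h \<ge> 12\<close>, the condition on the cube is weak, but the set is large, and what matters is that
  an element \<open>g\<close> is missing from the cube. Choosing \<open>x\<close> and \<open>s\<close> in \<open>T\<close> then forbids every \<open>y\<close> for
  which some product of \<open>x\<close>, \<open>s\<close>, \<open>y\<close> or their inverses, in any order, is \<open>g\<close>. Already \<open>1 \<in> S\<close>
  makes the remaining elements fall into few cells of mutually exclusive pairs, and counting cells
  cuts the search off early (\<open>search_sound\<close>, \<open>unavoidable_sound\<close>). It turns out that a slow set with
  \<open>h \<ge> 12\<close> can miss only \<open>-1\<close> and elements of order \<open>4\<close>, and that one with \<open>h \<ge> 14\<close> can miss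
  nothing. For \<open>h = 12\<close> and \<open>h = 13\<close> a slow set misses at least eight of the fifteen pairs of elements
  of order \<open>4\<close>; any eight contain a conjugate of one particular triple (\<open>crowded_triples\<close>), and the
  three elements of that triple cannot all be missing.

  The searches are functions on matrices over an enumerated copy of the field with five elements,
  with sets stored in tries, and are run by rewriting with their defining equations.
\<close>

section \<open>Two by two matrices over the field with five elements\<close>

datatype f5 = F0 | F1 | F2 | F3 | F4

instantiation f5 :: comm_ring_1
begin

definition "zero_f5 = F0"

definition "one_f5 = F1"

fun plus_f5 :: "f5 \<Rightarrow> f5 \<Rightarrow> f5" where
  "F0 + x = x"
| "F1 + F0 = F1" | "F1 + F1 = F2" | "F1 + F2 = F3" | "F1 + F3 = F4" | "F1 + F4 = F0"
| "F2 + F0 = F2" | "F2 + F1 = F3" | "F2 + F2 = F4" | "F2 + F3 = F0" | "F2 + F4 = F1"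
| "F3 + F0 = F3" | "F3 + F1 = F4" | "F3 + F2 = F0" | "F3 + F3 = F1" | "F3 + F4 = F2"
| "F4 + F0 = F4" | "F4 + F1 = F0" | "F4 + F2 = F1" | "F4 + F3 = F2" | "F4 + F4 = F3"

fun times_f5 :: "f5 \<Rightarrow> f5 \<Rightarrow> f5" where
  "F0 * x = F0"
| "F1 * x = x"
| "F2 * F0 = F0" | "F2 * F1 = F2" | "F2 * F2 = F4" | "F2 * F3 = F1" | "F2 * F4 = F3"
| "F3 * F0 = F0" | "F3 * F1 = F3" | "F3 * F2 = F1" | "F3 * F3 = F4" | "F3 * F4 = F2"
| "F4 * F0 = F0" | "F4 * F1 = F4" | "F4 * F2 = F3" | "F4 * F3 = F2" | "F4 * F4 = F1"

fun uminus_f5 :: "f5 \<Rightarrow> f5" where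
  "- F0 = F0" | "- F1 = F4" | "- F2 = F3" | "- F3 = F2" | "- F4 = F1"

definition minus_f5 :: "f5 \<Rightarrow> f5 \<Rightarrow> f5" where "minus_f5 x y = x + - y"

instance
proof
  fix a b c :: f5
  show "a + b + c = a + (b + c)" by (cases a; cases b; cases c; simp)
  show "a + b = b + a" by (cases a; cases b; simp)
  show "0 + a = a" by (simp add: zero_f5_def)
  show "- a + a = 0" by (cases a; simp add: zero_f5_def)
  show "a - b = a + - b" by (simp add: minus_f5_def)
  show "a * b * c = a * (b * c)" by (cases a; cases b; cases c; simp)
  show "a * b = b * a" by (cases a; cases b; simp)
  show "1 * a = a" by (simp add: one_f5_def)
  show "(a + b) * c = a * c + b * c" by (cases a; cases b; cases c; simp)
  show "(0::f5) \<noteq> 1" by (simp add: zero_f5_def one_f5_def)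
qed

end

text \<open>
  Fermat: it makes \<open>k ^ 3\<close> the inverse of \<open>k\<close>, which is how
  \<open>minv\<close> inverts a determinant.
\<close>

lemma f5_power_4: "k \<noteq> 0 \<Longrightarrow> k * k * k * k = (1::f5)"
  by (cases k) (simp_all add: zero_f5_def one_f5_def)

datatype mat = M f5 f5 f5 f5

instantiation mat :: monoid_mult
begin

definition "one_mat = M 1 0 0 1"

fun times_mat :: "mat \<Rightarrow> mat \<Rightarrow> mat" where
  "M a b c d * M e f g h = M (a * e + b * g) (a * f + b * h) (c * e + d * g) (c * f + d * h)"

instance
proof
  fix x y z :: mat
  show "x * y * z = x * (y * z)" by (cases x; cases y; cases z; simp add: algebra_simps)
  show "1 * x = x" "x * 1 = x" by (cases x; simp add: one_mat_def)+
qed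

end

fun dt :: "mat \<Rightarrow> f5" where "dt (M a b c d) = a * d - b * c"

fun tr :: "mat \<Rightarrow> f5" where "tr (M a b c d) = a + d"

text \<open>
  The adjugate, which on matrices of determinant \<open>1\<close> is the inverse.
\<close>

fun adj :: "mat \<Rightarrow> mat" where "adj (M a b c d) = M d (- b) (- c) a"

fun scal :: "f5 \<Rightarrow> mat \<Rightarrow> mat" where "scal k (M a b c d) = M (k * a) (k * b) (k * c) (k * d)"

definition neg1 :: mat where "neg1 = M (- 1) 0 0 (- 1)"

definition SLm :: "mat set" where "SLm = {x. dt x = 1}"

lemma dt_mult: "dt (x * y) = dt x * dt y"
  by (cases x; cases y; simp add: algebra_simps)

lemma adj_mult: "adj (x * y) = adj y * adj x"
  by (cases x; cases y; simp add: algebra_simps)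

lemma adj_adj [simp]: "adj (adj x) = x"
  by (cases x) simp

lemma dt_adj [simp]: "dt (adj x) = dt x"
  by (cases x) (simp add: algebra_simps)

lemma mult_adj_scal: "x * adj x = scal (dt x) 1" "adj x * x = scal (dt x) 1"
  by (cases x; simp add: one_mat_def algebra_simps)+

lemma scal_one [simp]: "scal 1 x = x"
  by (cases x) simp

lemma scal_mult: "scal k (x * y) = scal k x * y" "scal k (x * y) = x * scal k y"
  by (cases x; cases y; simp add: algebra_simps)+

lemma scal_scal: "scal k (scal l x) = scal (k * l) x"
  by (cases x) (simp add: algebra_simps)

lemma mult_adj [simp]: "x \<in> SLm \<Longrightarrow> x * adj x = 1" "x \<in> SLm \<Longrightarrow> adj x * x = 1"
  by (simp_all add: mult_adj_scal SLm_def)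

lemma mult_in_SLm [simp]: "x \<in> SLm \<Longrightarrow> y \<in> SLm \<Longrightarrow> x * y \<in> SLm"
  by (simp add: SLm_def dt_mult)

lemma adj_in_SLm [simp]: "adj x \<in> SLm \<longleftrightarrow> x \<in> SLm"
  by (simp add: SLm_def)

lemma one_in_SLm [simp]: "1 \<in> SLm"
  by (simp add: SLm_def one_mat_def)

lemma neg1_in_SLm [simp]: "neg1 \<in> SLm"
  by (simp add: SLm_def neg1_def)

lemma adj_one [simp]: "adj 1 = 1"
  by (simp add: one_mat_def)

lemma adj_neg1 [simp]: "adj neg1 = neg1"
  by (simp add: neg1_def)

lemma adj_unique: "x \<in> SLm \<Longrightarrow> x * y = 1 \<Longrightarrow> y = adj x"
  by (metis mult.assoc mult.left_neutral mult.right_neutral mult_adj(2))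

lemma adj_mult_cancel [simp]: "x \<in> SLm \<Longrightarrow> adj x * (x * y) = y" "x \<in> SLm \<Longrightarrow> x * (adj x * y) = y"
  by (metis mult.assoc mult.left_neutral mult_adj)+

lemma SLm_mult_left_cancel: "x \<in> SLm \<Longrightarrow> x * y = x * z \<longleftrightarrow> y = z"
  by (metis adj_mult_cancel(1))

definition f5s :: "f5 list" where "f5s = [F0, F1, F2, F3, F4]"

definition sl :: "mat list" where
  "sl = [M a b c d. a \<leftarrow> f5s, b \<leftarrow> f5s, c \<leftarrow> f5s, d \<leftarrow> f5s, dt (M a b c d) = 1]"

lemma set_f5s: "set f5s = UNIV"
  by (auto simp: f5s_def intro: f5.exhaust)

lemma set_sl: "set sl = SLm"
proof -
  have "x \<in> set sl \<longleftrightarrow> x \<in> SLm" for x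
    by (cases x) (auto simp: sl_def set_f5s SLm_def)
  then show ?thesis by blast
qed

lemma length_sl: "length sl = 120"
  by code_simp

lemma finite_SLm [simp]: "finite SLm"
  by (metis List.finite_set set_sl)

section \<open>Symmetric sets, their cubes, and conjugation\<close>

definition symm :: "mat set \<Rightarrow> bool" where "symm T \<longleftrightarrow> (\<forall>x\<in>T. adj x \<in> T)"

definition cub :: "mat set \<Rightarrow> mat set" where
  "cub W = {a * b * c | a b c. a \<in> W \<and> b \<in> W \<and> c \<in> W}"

text \<open>
  The identity is added because an admissible set contains it; the sets \<open>T\<close> below
  omit the central elements.
\<close>

definition missing :: "mat set \<Rightarrow> mat set" where
  "missing T = SLm - cub (insert 1 T)"

text \<open>
  For a set \<open>T\<close> with the central elements removed, this says that \<open>T\<close>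
  together with the centre generates the group. In a finite group a subset that contains
  \<open>1\<close> and is closed under products is a subgroup, so inverses need not be
  mentioned.
\<close>

definition spans :: "mat set \<Rightarrow> bool" where
  "spans T \<longleftrightarrow> (\<forall>H. T \<subseteq> H \<longrightarrow> 1 \<in> H \<longrightarrow> neg1 \<in> H \<longrightarrow> (\<forall>x\<in>H. \<forall>y\<in>H. x * y \<in> H) \<longrightarrow> SLm \<subseteq> H)"

lemma cubI: "a \<in> W \<Longrightarrow> b \<in> W \<Longrightarrow> c \<in> W \<Longrightarrow> a * b * c \<in> cub W"
  by (auto simp: cub_def)

lemma cub_mono: "V \<subseteq> W \<Longrightarrow> cub V \<subseteq> cub W"
  by (fastforce simp: cub_def)

lemma cub_subset_SLm: "W \<subseteq> SLm \<Longrightarrow> cub W \<subseteq> SLm"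
  by (auto simp: cub_def subset_iff)

lemma adj_in_cub: "symm W \<Longrightarrow> x \<in> cub W \<Longrightarrow> adj x \<in> cub W"
  unfolding cub_def symm_def by (fastforce simp: adj_mult mult.assoc)

lemma symm_adj_iff: "symm T \<Longrightarrow> adj x \<in> T \<longleftrightarrow> x \<in> T"
  by (metis adj_adj symm_def)

lemma symm_insert_one: "symm T \<Longrightarrow> symm (insert 1 T)"
  by (auto simp: symm_def)

definition minv :: "mat \<Rightarrow> mat" where "minv P = scal (dt P * dt P * dt P) (adj P)"

definition cj :: "mat \<Rightarrow> mat \<Rightarrow> mat" where "cj P x = P * x * minv P"

text \<open>
  The inverse of \<open>cj\<close>. A set \<open>T\<close> contains \<open>cj P x\<close> iff
  its image under \<open>uncj P\<close> contains \<open>x\<close>; this is why closure of a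
  class of sets is stated with \<open>uncj\<close>.
\<close>

definition uncj :: "mat \<Rightarrow> mat \<Rightarrow> mat" where "uncj P x = minv P * x * P"

lemma mult_minv:
  assumes "dt P \<noteq> 0"
  shows "P * minv P = 1" "minv P * P = 1"
proof -
  have "P * minv P = scal (dt P * dt P * dt P) (P * adj P)"
    unfolding minv_def by (rule scal_mult(2)[symmetric])
  moreover have "minv P * P = scal (dt P * dt P * dt P) (adj P * P)"
    unfolding minv_def by (rule scal_mult(1)[symmetric])
  ultimately show "P * minv P = 1" "minv P * P = 1"
    using f5_power_4[OF assms] by (simp_all add: mult_adj_scal scal_scal)
qed

lemma uncj_cj: "dt P \<noteq> 0 \<Longrightarrow> uncj P (cj P x) = x"
  using mult_minv[of P] by (metis (no_types) cj_def uncj_def mult.assoc mult.left_neutral mult.right_neutral)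

lemma cj_uncj: "dt P \<noteq> 0 \<Longrightarrow> cj P (uncj P x) = x"
  using mult_minv[of P] by (metis (no_types) cj_def uncj_def mult.assoc mult.left_neutral mult.right_neutral)

lemma uncj_mult: "dt P \<noteq> 0 \<Longrightarrow> uncj P (x * y) = uncj P x * uncj P y"
  using mult_minv[of P] by (simp add: uncj_def mult.assoc) (metis (no_types) mult.assoc mult.left_neutral)

lemma neg1_commutes: "neg1 * x = x * neg1"
  by (cases x) (simp add: neg1_def)

lemma uncj_fixed: "dt P \<noteq> 0 \<Longrightarrow> uncj P 1 = 1" "dt P \<noteq> 0 \<Longrightarrow> uncj P neg1 = neg1"
  using mult_minv[of P] by (simp_all add: uncj_def neg1_commutes[symmetric] mult.assoc)

lemma uncj_in_SLm:
  assumes "dt P \<noteq> 0"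
  shows "uncj P x \<in> SLm \<longleftrightarrow> x \<in> SLm"
proof -
  have "dt (minv P * x * P) = dt (minv P * P) * dt x"
    by (simp add: dt_mult ac_simps)
  also have "\<dots> = dt x"
    using one_in_SLm by (simp add: mult_minv assms SLm_def)
  finally show ?thesis by (simp add: uncj_def SLm_def)
qed

lemma uncj_inj: "dt P \<noteq> 0 \<Longrightarrow> uncj P x = uncj P y \<longleftrightarrow> x = y"
  by (metis cj_uncj)

lemma image_uncj_SLm: "dt P \<noteq> 0 \<Longrightarrow> uncj P ` SLm = SLm"
  by (rule endo_inj_surj) (auto simp: uncj_in_SLm uncj_inj inj_on_def)

lemma uncj_adj:
  assumes "dt P \<noteq> 0" "x \<in> SLm" shows "uncj P (adj x) = adj (uncj P x)"
proof (rule adj_unique)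
  show "uncj P x \<in> SLm" using assms by (simp add: uncj_in_SLm)
  show "uncj P x * uncj P (adj x) = 1"
    using assms by (simp add: uncj_mult[symmetric] uncj_fixed)
qed

lemma cub_image_uncj: "dt P \<noteq> 0 \<Longrightarrow> cub (uncj P ` W) = uncj P ` cub W"
proof (intro equalityI subsetI)
  assume P: "dt P \<noteq> 0"
  fix x assume "x \<in> cub (uncj P ` W)"
  then obtain a b c where "a \<in> W" "b \<in> W" "c \<in> W" "x = uncj P a * uncj P b * uncj P c"
    by (auto simp: cub_def)
  then show "x \<in> uncj P ` cub W"
    using P by (auto simp: uncj_mult[symmetric] intro!: imageI cubI)
next
  assume P: "dt P \<noteq> 0"
  fix x assume "x \<in> uncj P ` cub W"
  then obtain a b c where "a \<in> W" "b \<in> W" "c \<in> W" "x = uncj P (a * b * c)"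
    by (auto simp: cub_def)
  then show "x \<in> cub (uncj P ` W)"
    using P by (auto simp: uncj_mult intro!: cubI)
qed

lemma insert_one_uncj: "dt P \<noteq> 0 \<Longrightarrow> insert 1 (uncj P ` T) = uncj P ` insert 1 T"
  by (simp add: uncj_fixed)

lemma missing_image_uncj: "dt P \<noteq> 0 \<Longrightarrow> missing (uncj P ` T) = uncj P ` missing T"
  unfolding missing_def insert_one_uncj cub_image_uncj
  by (subst image_uncj_SLm[symmetric], assumption, rule image_set_diff[symmetric])
     (simp add: inj_def uncj_inj)

lemma card_image_uncj: "dt P \<noteq> 0 \<Longrightarrow> card (uncj P ` T) = card T"
  by (rule card_image) (simp add: inj_on_def uncj_inj)

lemma symm_image_uncj: "dt P \<noteq> 0 \<Longrightarrow> T \<subseteq> SLm \<Longrightarrow> symm T \<Longrightarrow> symm (uncj P ` T)"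
  by (auto simp: symm_def subset_iff uncj_adj[symmetric])

lemma spans_image_uncj:
  assumes P: "dt P \<noteq> 0" and T: "spans T" shows "spans (uncj P ` T)"
  unfolding spans_def
proof (intro allI impI subsetI)
  fix H x
  assume H: "uncj P ` T \<subseteq> H" "1 \<in> H" "neg1 \<in> H" "\<forall>x\<in>H. \<forall>y\<in>H. x * y \<in> H" and x: "x \<in> SLm"
  \<comment> \<open>The preimage of \<open>H\<close> under the automorphism is a subgroup that contains \<open>T\<close>.\<close>
  let ?K = "{y. uncj P y \<in> H}"
  have "SLm \<subseteq> ?K"
    using T[unfolded spans_def, rule_format, of ?K] H by (auto simp: P uncj_fixed uncj_mult)
  moreover obtain y where "y \<in> SLm" "x = uncj P y"
    using x image_uncj_SLm[OF P] by auto
  ultimately show "x \<in> H" by auto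
qed

text \<open>
  Beyond its end the list continues with its last entry.
\<close>

fun thr :: "nat list \<Rightarrow> nat \<Rightarrow> nat" where
  "thr [] n = 0"
| "thr [t] n = t"
| "thr (t # u # ts) 0 = t"
| "thr (t # u # ts) (Suc n) = thr (u # ts) n"

definition small_slacks :: "nat list" where
  "small_slacks = [117, 113, 107, 101, 95, 88, 80, 72, 64, 55, 45, 36]"

text \<open>
  The number of group elements that the cube of \<open>{1} \<union> T\<close> may miss when
  \<open>T\<close> consists of \<open>h\<close> inverse pairs: \<open>slack h\<close> is
  \<open>120\<close> minus the least integer that is at least \<open>(2 * h + 2) powr (ln 114 /
  ln 30)\<close>, and \<open>0\<close> from \<open>h = 15\<close> on, where that integer exceeds
  \<open>120\<close>.
\<close>

definition slack :: "nat \<Rightarrow> nat" where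
  "slack = thr (small_slacks @ [26, 16, 6, 0])"

text \<open>
  Monotonicity lets a bound for the largest size that a partial set can still reach serve for
  all sizes below it.
\<close>

lemma antimono_thr: "sorted_wrt (\<ge>) ts \<Longrightarrow> antimono (thr ts)"
proof (induction ts)
  case Nil then show ?case by (simp add: antimono_def)
next
  case (Cons t ts)
  show ?case
  proof (cases ts)
    case Nil then show ?thesis by (simp add: antimono_def)
  next
    case (Cons u us)
    have le: "thr (u # us) n \<le> u" for n
      using antimonoD[OF Cons.IH, of 0 n] Cons.prems \<open>ts = u # us\<close> by (cases us) auto
    have "thr (t # ts) n \<le> thr (t # ts) m" if "m \<le> n" for m n
      using that le Cons.prems \<open>ts = u # us\<close> antimonoD[OF Cons.IH]
      by (cases m; cases n) (auto intro: order_trans)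
    then show ?thesis by (simp add: antimono_def)
  qed
qed

lemma antimono_slack: "antimono slack"
  unfolding slack_def by (rule antimono_thr) (simp add: small_slacks_def)

lemma thr_append: "n < length ts \<Longrightarrow> thr (ts @ us) n = thr ts n"
proof (induction ts n rule: thr.induct)
  case (2 t n)
  then show ?case by (cases us) auto
qed auto

text \<open>
  Rounding up spares the proof that symmetric sets without central elements have even size.
\<close>

definition pairs :: "mat set \<Rightarrow> nat" where "pairs T = (card T + 1) div 2"

definition slow :: "mat set \<Rightarrow> bool" where
  "slow T \<longleftrightarrow> symm T \<and> T \<subseteq> SLm - {1, neg1} \<and> spans T \<and> slack (pairs T) < card (missing T)"

text \<open>
  Conjugation by \<open>GL(2,5)\<close> is an automorphism of the group that fixes the centre,
  and slowness is defined in terms of the group structure alone.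
\<close>

lemma slow_image_uncj:
  assumes P: "dt P \<noteq> 0" and T: "slow T" shows "slow (uncj P ` T)"
proof -
  have "uncj P x \<noteq> 1" "uncj P x \<noteq> neg1" if "x \<in> T" for x
    using that T uncj_inj[OF P, of x] uncj_fixed[OF P] unfolding slow_def by (metis Diff_iff insertCI subsetD)+
  then show ?thesis
    using assms unfolding slow_def
    by (auto simp: symm_image_uncj spans_image_uncj missing_image_uncj card_image_uncj pairs_def uncj_in_SLm subset_iff)
qed

section \<open>Tries as finite sets of matrices\<close>

text \<open>
  A trie branches on field elements. \<open>Full\<close> marks the end of a path.
\<close>

datatype trie = Empty | Full | Node trie trie trie trie trie

fun insert_path :: "f5 list \<Rightarrow> trie \<Rightarrow> trie" where
  "insert_path [] t = Full"
| "insert_path (i # p) Full = Full"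
| "insert_path (F0 # p) Empty = Node (insert_path p Empty) Empty Empty Empty Empty"
| "insert_path (F1 # p) Empty = Node Empty (insert_path p Empty) Empty Empty Empty"
| "insert_path (F2 # p) Empty = Node Empty Empty (insert_path p Empty) Empty Empty"
| "insert_path (F3 # p) Empty = Node Empty Empty Empty (insert_path p Empty) Empty"
| "insert_path (F4 # p) Empty = Node Empty Empty Empty Empty (insert_path p Empty)"
| "insert_path (F0 # p) (Node a b c d e) = Node (insert_path p a) b c d e"
| "insert_path (F1 # p) (Node a b c d e) = Node a (insert_path p b) c d e"
| "insert_path (F2 # p) (Node a b c d e) = Node a b (insert_path p c) d e"
| "insert_path (F3 # p) (Node a b c d e) = Node a b c (insert_path p d) e"
| "insert_path (F4 # p) (Node a b c d e) = Node a b c d (insert_path p e)"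

fun has_path :: "f5 list \<Rightarrow> trie \<Rightarrow> bool" where
  "has_path p Empty = False"
| "has_path p Full = True"
| "has_path [] (Node a b c d e) = False"
| "has_path (F0 # p) (Node a b c d e) = has_path p a"
| "has_path (F1 # p) (Node a b c d e) = has_path p b"
| "has_path (F2 # p) (Node a b c d e) = has_path p c"
| "has_path (F3 # p) (Node a b c d e) = has_path p d"
| "has_path (F4 # p) (Node a b c d e) = has_path p e"

text \<open>
  Three entries determine a matrix of determinant \<open>1\<close>, provided that the omitted
  one has a nonzero cofactor; hence the case distinction on the upper left entry. Short keys
  keep the tries small, and rewriting is the faster the smaller the terms are.
\<close>

fun key :: "mat \<Rightarrow> f5 list" where
  "key (M F0 b c d) = [F0, c, d]"
| "key (M F1 b c d) = [F1, c, b]"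
| "key (M F2 b c d) = [F2, c, b]"
| "key (M F3 b c d) = [F3, c, b]"
| "key (M F4 b c d) = [F4, c, b]"

definition ins :: "mat \<Rightarrow> trie \<Rightarrow> trie" where "ins x t = insert_path (key x) t"

definition mem :: "mat \<Rightarrow> trie \<Rightarrow> bool" where "mem x t \<longleftrightarrow> has_path (key x) t"

definition elems :: "trie \<Rightarrow> mat set" where "elems t = {x \<in> SLm. mem x t}"

fun inss :: "mat list \<Rightarrow> trie \<Rightarrow> trie" where
  "inss [] t = t"
| "inss (x # xs) t = inss xs (ins x t)"

lemma has_insert_path:
  "length p = length q \<Longrightarrow> has_path p (insert_path q t) \<longleftrightarrow> p = q \<or> has_path p t"
proof (induction q arbitrary: p t)
  case (Cons i q)
  then obtain j p' where "p = j # p'" "length p' = length q"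
    by (auto simp: length_Suc_conv)
  with Cons.IH[of p'] show ?case
    by (cases t; cases i; cases j; simp)
qed simp

lemma length_key: "length (key x) = 3"
  by (cases x rule: key.cases) auto

lemma f5_mult_cancel: "k \<noteq> 0 \<Longrightarrow> k * x = k * y \<longleftrightarrow> x = (y::f5)"
  by (cases k; cases x; cases y) (simp_all add: zero_f5_def)

text \<open>
  With \<open>a \<noteq> 0\<close> the entry \<open>d\<close> is \<open>(1 + b * c) / a\<close>;
  with \<open>a = 0\<close> the entry \<open>b\<close> is \<open>- 1 / c\<close>.
\<close>

lemma key_inj: "\<And>x y. x \<in> SLm \<Longrightarrow> y \<in> SLm \<Longrightarrow> key x = key y \<Longrightarrow> x = y"
proof -
  fix x y assume xy: "x \<in> SLm" "y \<in> SLm" "key x = key y"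
  obtain a b c d where x: "x = M a b c d" by (cases x)
  obtain a' b' c' d' where y: "y = M a' b' c' d'" by (cases y)
  have dt: "a * d - b * c = 1" "a' * d' - b' * c' = 1"
    using xy x y by (simp_all add: SLm_def)
  show "x = y"
  proof (cases "a = 0")
    case True
    then have eq: "a' = 0" "c' = c" "d' = d"
      using xy(3) unfolding x y zero_f5_def by (cases a'; simp)+
    then have bc: "b * c = - 1" "b' * c = - 1"
      using dt True by (metis add.inverse_inverse diff_0 mult_zero_left)+
    then have "c * b = c * b'"
      by (simp add: mult.commute)
    moreover have "c \<noteq> 0"
      using bc by auto
    ultimately have "b = b'"
      by (simp add: f5_mult_cancel)
    then show ?thesis using True eq by (simp add: x y)
  next
    case False
    then have eq: "a' = a" "c' = c" "b' = b"
      using xy(3) unfolding x y zero_f5_def by (cases a; cases a'; simp)+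
    then have "a * d = a * d'"
      using dt by (metis diff_add_cancel)
    then show ?thesis using False eq by (simp add: x y f5_mult_cancel)
  qed
qed

lemma mem_ins: "x \<in> SLm \<Longrightarrow> y \<in> SLm \<Longrightarrow> mem y (ins x t) \<longleftrightarrow> y = x \<or> mem y t"
  using key_inj by (auto simp: mem_def ins_def has_insert_path length_key)

lemma elems_Empty [simp]: "elems Empty = {}"
  by (simp add: elems_def mem_def)

lemma elems_ins [simp]: "x \<in> SLm \<Longrightarrow> elems (ins x t) = insert x (elems t)"
  by (auto simp: elems_def mem_ins)

lemma elems_inss [simp]: "set xs \<subseteq> SLm \<Longrightarrow> elems (inss xs t) = set xs \<union> elems t"
  by (induction xs arbitrary: t) auto

lemma elems_subset: "elems t \<subseteq> SLm"
  by (auto simp: elems_def)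

lemma finite_elems [simp]: "finite (elems t)"
  using elems_subset finite_SLm finite_subset by blast

lemma mem_elems: "x \<in> SLm \<Longrightarrow> mem x t \<longleftrightarrow> x \<in> elems t"
  by (simp add: elems_def)

section \<open>Striking out conjugacy orbits\<close>

text \<open>
  The class \<open>\<V>\<close> collects the potential counterexamples.
\<close>

definition dead :: "mat set set \<Rightarrow> mat \<Rightarrow> bool" where
  "dead \<V> x \<longleftrightarrow> (\<forall>T\<in>\<V>. x \<notin> T)"

lemma deadI: "(\<And>T. T \<in> \<V> \<Longrightarrow> x \<notin> T) \<Longrightarrow> dead \<V> x"
  by (simp add: dead_def)

lemma cj_in_SLm: "dt P \<noteq> 0 \<Longrightarrow> cj P x \<in> SLm \<longleftrightarrow> x \<in> SLm"
  by (metis cj_uncj uncj_cj uncj_in_SLm)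

lemma dead_cj:
  assumes P: "dt P \<noteq> 0" and closed: "\<And>T. T \<in> \<V> \<Longrightarrow> uncj P ` T \<in> \<V>" and "dead \<V> x"
  shows "dead \<V> (cj P x)"
  using assms uncj_cj[OF P, of x] unfolding dead_def by (metis imageI)

text \<open>
  Representatives of \<open>GL(2,5)\<close> modulo scalars, normalised so that the first nonzero
  entry of the upper row is \<open>1\<close>; scalars conjugate trivially.
\<close>

definition pgl :: "mat list" where
  "pgl = [P \<leftarrow> [M 1 b c d. b \<leftarrow> f5s, c \<leftarrow> f5s, d \<leftarrow> f5s] @ [M 0 1 c d. c \<leftarrow> f5s, d \<leftarrow> f5s]. dt P \<noteq> 0]"

lemma dt_pgl: "P \<in> set pgl \<Longrightarrow> dt P \<noteq> 0"
  by (auto simp: pgl_def)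

text \<open>
  Conjugations that preserve \<open>G\<close> up to inverses.
\<close>

definition stab :: "mat list \<Rightarrow> mat list" where
  "stab G = [P \<leftarrow> pgl. list_all (\<lambda>g. cj P g \<in> set G \<or> adj (cj P g) \<in> set G) G]"

fun orbit :: "mat list \<Rightarrow> mat \<Rightarrow> trie \<Rightarrow> trie" where
  "orbit [] x D = D"
| "orbit (P # Ps) x D = orbit Ps x (ins (cj P x) (ins (adj (cj P x)) D))"

fun orbits :: "mat list \<Rightarrow> mat list \<Rightarrow> trie \<Rightarrow> trie" where
  "orbits Ps [] D = D"
| "orbits Ps (x # xs) D = orbits Ps xs (orbit Ps x D)"

lemma elems_orbit:
  "(\<And>P. P \<in> set Ps \<Longrightarrow> dt P \<noteq> 0) \<Longrightarrow> x \<in> SLm \<Longrightarrow>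
    elems (orbit Ps x D) = elems D \<union> {cj P x | P. P \<in> set Ps} \<union> {adj (cj P x) | P. P \<in> set Ps}"
  by (induction Ps arbitrary: D) (auto simp: cj_in_SLm)

text \<open>
  The trie \<open>D\<close> collects dead elements. The function \<open>test x D\<close> may use
  that all of \<open>D\<close> is dead in order to show that \<open>x\<close> is dead, and then
  the whole orbit of \<open>x\<close> joins \<open>D\<close>.
\<close>

fun sweep :: "(mat \<Rightarrow> trie \<Rightarrow> bool) \<Rightarrow> mat list \<Rightarrow> mat list \<Rightarrow> trie \<Rightarrow> trie" where
  "sweep test Ps [] D = D"
| "sweep test Ps (x # xs) D =
    (if mem x D then sweep test Ps xs D
     else if test x D then sweep test Ps xs (orbit Ps x D)
     else sweep test Ps xs D)"

text \<open>
  A class of symmetric sets that is closed under the conjugations in \<open>Ps\<close>, so that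
  being dead is a property of orbits.
\<close>

locale conj_class =
  fixes \<V> :: "mat set set" and Ps :: "mat list"
  assumes symm: "T \<in> \<V> \<Longrightarrow> symm T"
    and units: "P \<in> set Ps \<Longrightarrow> dt P \<noteq> 0"
    and closed: "P \<in> set Ps \<Longrightarrow> T \<in> \<V> \<Longrightarrow> uncj P ` T \<in> \<V>"
begin

lemma dead_adj: "dead \<V> (adj x) \<longleftrightarrow> dead \<V> x"
  unfolding dead_def using symm symm_adj_iff by blast

lemma dead_orbit:
  assumes "x \<in> SLm" "dead \<V> x" "\<forall>y\<in>elems D. dead \<V> y"
  shows "\<forall>y\<in>elems (orbit Ps x D). dead \<V> y"
  using assms dead_cj[OF units closed, of _ x] by (auto simp: elems_orbit units dead_adj)

lemma dead_orbits:
  assumes "set xs \<subseteq> SLm" "\<forall>x\<in>set xs. dead \<V> x" "\<forall>y\<in>elems D. dead \<V> y"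
  shows "\<forall>y\<in>elems (orbits Ps xs D). dead \<V> y"
  using assms
proof (induction xs arbitrary: D)
  case (Cons x xs)
  have "\<forall>y\<in>elems (orbit Ps x D). dead \<V> y"
    using Cons.prems by (intro dead_orbit) auto
  then show ?case
    using Cons.IH[of "orbit Ps x D"] Cons.prems by simp
qed simp

text \<open>
  An orbit is struck out after a single test because deadness refers to the whole class
  \<open>\<V>\<close> and not to what is left of the candidates.
\<close>

lemma dead_sweep:
  assumes test: "\<And>x D. x \<in> set xs \<Longrightarrow> test x D \<Longrightarrow> \<forall>y\<in>elems D. dead \<V> y \<Longrightarrow> dead \<V> x"
    and xs: "set xs \<subseteq> SLm" and "\<forall>y\<in>elems D. dead \<V> y"
  shows "\<forall>y\<in>elems (sweep test Ps xs D). dead \<V> y"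
  using assms
proof (induction xs arbitrary: D)
  case (Cons x xs)
  have IH: "\<forall>y\<in>elems D'. dead \<V> y \<Longrightarrow> \<forall>y\<in>elems (sweep test Ps xs D'). dead \<V> y" for D'
    by (rule Cons.IH) (use Cons.prems(1,2) in auto)
  show ?case
  proof (cases "\<not> mem x D \<and> test x D")
    case True
    then have eq: "sweep test Ps (x # xs) D = sweep test Ps xs (orbit Ps x D)" by simp
    have "dead \<V> x" using True Cons.prems by auto
    then show ?thesis
      unfolding eq using Cons.prems by (intro IH dead_orbit) auto
  next
    case False
    then have eq: "sweep test Ps (x # xs) D = sweep test Ps xs D" by auto
    show ?thesis unfolding eq by (rule IH[OF Cons.prems(3)])
  qed
qed simp

end

section \<open>Counting the elements of a cube\<close>

fun put_if :: "bool \<Rightarrow> mat \<Rightarrow> nat \<Rightarrow> trie \<Rightarrow> nat \<times> trie" where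
  "put_if True x r Q = (Suc r, Q)"
| "put_if False x r Q = (r, ins x Q)"

text \<open>
  A state \<open>(r, Q)\<close> consists of a trie \<open>Q\<close> of elements found so far and
  the number \<open>r\<close> of further elements that are of interest. Counting down lets a
  computation stop as soon as enough elements have been found. The auxiliary functions that take
  a Boolean are there because rewriting normalises the chosen branch of a conditional again,
  whereas pattern matching on a Boolean does not.
\<close>

fun put :: "mat \<Rightarrow> nat \<times> trie \<Rightarrow> nat \<times> trie" where
  "put x (0, Q) = (0, Q)"
| "put x (Suc r, Q) = put_if (mem x Q) x r Q"

fun puts :: "mat list \<Rightarrow> nat \<times> trie \<Rightarrow> nat \<times> trie" where
  "puts [] st = st"
| "puts (x # xs) st = puts xs (put x st)"

text \<open>
  Products \<open>x * p\<close> with \<open>p\<close> in the square of a set, and their inverses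
  \<open>adj p * adj x\<close>.
\<close>

fun cubes :: "mat \<Rightarrow> mat list \<Rightarrow> nat \<times> trie \<Rightarrow> nat \<times> trie" where
  "cubes x [] st = st"
| "cubes x (p # ps) (0, Q) = (0, Q)"
| "cubes x (p # ps) (Suc r, Q) = cubes x ps (put (x * p) (put (adj (x * p)) (Suc r, Q)))"

fun add_if :: "bool \<Rightarrow> mat \<Rightarrow> mat list \<Rightarrow> trie \<Rightarrow> mat list \<times> trie" where
  "add_if True x ps t = (ps, t)"
| "add_if False x ps t = (x # ps, ins x t)"

fun add :: "mat \<Rightarrow> mat list \<times> trie \<Rightarrow> mat list \<times> trie" where
  "add x (ps, t) = add_if (mem x t) x ps t"

fun squares :: "mat \<Rightarrow> mat list \<Rightarrow> mat list \<times> trie \<Rightarrow> mat list \<times> trie" where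
  "squares x [] P = P"
| "squares x (s # S) P = squares x S (add (x * s) (add (adj (x * s)) P))"

text \<open>
  Extends a list of elements of the square when the pair of \<open>x\<close> joins
  \<open>S\<close>.
\<close>

definition squares2 :: "mat \<Rightarrow> mat list \<Rightarrow> mat list \<times> trie \<Rightarrow> mat list \<times> trie" where
  "squares2 x S P = squares x S (squares (adj x) S P)"

text \<open>
  Adds only those elements of the cube that have \<open>x\<close> or its inverse at one end. A
  lower bound for the cube is all that is needed.
\<close>

definition cubes2 :: "mat \<Rightarrow> mat list \<times> trie \<Rightarrow> nat \<times> trie \<Rightarrow> nat \<times> trie" where
  "cubes2 x P st = cubes x (fst P) (cubes (adj x) (fst P) st)"

definition sq :: "mat set \<Rightarrow> mat set" where "sq W = {a * b | a b. a \<in> W \<and> b \<in> W}"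

text \<open>
  The invariant of the states: the elements in the trie belong to \<open>C\<close>, and at most
  \<open>r\<close> of \<open>n\<close> elements have not been found.
\<close>

definition counts :: "mat set \<Rightarrow> nat \<Rightarrow> nat \<times> trie \<Rightarrow> bool" where
  "counts C n st \<longleftrightarrow> elems (snd st) \<subseteq> C \<and> n \<le> fst st + card (elems (snd st))"

lemma counts_put: "counts C n st \<Longrightarrow> x \<in> SLm \<Longrightarrow> x \<in> C \<Longrightarrow> counts C n (put x st)"
  by (cases "(x, st)" rule: put.cases; cases "mem x (snd st)")
     (auto simp: counts_def mem_elems card_insert_if)

lemma sq_cub: "x \<in> W \<Longrightarrow> p \<in> sq W \<Longrightarrow> x * p \<in> cub W"
  by (auto simp: sq_def mult.assoc[symmetric] intro!: cubI)

lemma counts_cubes: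
  assumes W: "symm W" "W \<subseteq> SLm" and x: "x \<in> W"
  shows "counts (cub W) n st \<Longrightarrow> set ps \<subseteq> sq W \<Longrightarrow> counts (cub W) n (cubes x ps st)"
proof (induction ps arbitrary: st)
  case (Cons p ps)
  have "x * p \<in> cub W" "adj (x * p) \<in> cub W"
    using sq_cub adj_in_cub W x Cons.prems(2) by auto
  moreover from this have "x * p \<in> SLm" "adj (x * p) \<in> SLm"
    using cub_subset_SLm[OF W(2)] by auto
  ultimately have put: "counts (cub W) n (put (x * p) (put (adj (x * p)) st))"
    using Cons.prems(1) by (intro counts_put)
  obtain r Q where st: "st = (r, Q)" by (cases st)
  show ?case
    using Cons.IH[OF put] Cons.prems by (cases r) (auto simp: st simp del: put.simps)
qed simp

lemma set_add: "set (fst (add x P)) \<subseteq> insert x (set (fst P))"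
  by (cases "(x, P)" rule: add.cases; cases "mem x (snd P)") auto

lemma set_squares:
  assumes "symm W" "x \<in> W"
  shows "set S \<subseteq> W \<Longrightarrow> set (fst P) \<subseteq> sq W \<Longrightarrow> set (fst (squares x S P)) \<subseteq> sq W"
proof (induction S arbitrary: P)
  case (Cons s S)
  have "x * s \<in> sq W" "adj (x * s) \<in> sq W"
    using assms Cons.prems unfolding sq_def adj_mult symm_def by auto
  then have "set (fst (add (x * s) (add (adj (x * s)) P))) \<subseteq> sq W"
    using set_add[of "x * s" "add (adj (x * s)) P"] set_add[of "adj (x * s)" P] Cons.prems by auto
  then show ?case using Cons by simp
qed simp

lemma set_squares2:
  "symm W \<Longrightarrow> x \<in> W \<Longrightarrow> set S \<subseteq> W \<Longrightarrow> set (fst P) \<subseteq> sq W \<Longrightarrow> set (fst (squares2 x S P)) \<subseteq> sq W"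
  unfolding squares2_def by (intro set_squares) (auto simp: symm_def)

lemma counts_cubes2:
  "symm W \<Longrightarrow> W \<subseteq> SLm \<Longrightarrow> x \<in> W \<Longrightarrow> counts (cub W) n st \<Longrightarrow> set (fst P) \<subseteq> sq W \<Longrightarrow>
    counts (cub W) n (cubes2 x P st)"
  unfolding cubes2_def by (intro counts_cubes) (auto simp: symm_def)

text \<open>
  The list \<open>sl\<close> has \<open>120\<close> entries, and counting finds
  \<open>120\<close> different ones.
\<close>

lemma card_SLm: "card SLm = 120"
proof (rule antisym)
  show "card SLm \<le> 120"
    by (metis card_length length_sl set_sl)
  have "counts SLm 120 st \<Longrightarrow> set xs \<subseteq> SLm \<Longrightarrow> counts SLm 120 (puts xs st)" for xs st
  proof (induction xs arbitrary: st)
    case (Cons x xs)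
    then show ?case using Cons.IH[OF counts_put[OF Cons.prems(1)]] by simp
  qed simp
  then have "counts SLm 120 (puts sl (120, Empty))"
    by (simp add: set_sl counts_def)
  moreover have "fst (puts sl (120, Empty)) = 0"
    by code_simp
  ultimately have "120 \<le> card (elems (snd (puts sl (120, Empty))))"
    by (simp add: counts_def)
  also have "\<dots> \<le> card SLm"
    by (rule card_mono[OF finite_SLm elems_subset])
  finally show "120 \<le> card SLm" .
qed

lemma card_missing:
  assumes "T \<subseteq> SLm" shows "card (missing T) + card (cub (insert 1 T)) = 120"
proof -
  have "cub (insert 1 T) \<subseteq> SLm"
    using assms by (intro cub_subset_SLm) auto
  then show ?thesis
    by (simp add: missing_def card_Diff_subset finite_subset card_SLm[symmetric] card_mono)
qed

lemma card_missing_le: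
  assumes "T \<subseteq> SLm" "counts (cub (insert 1 T)) 120 st" shows "card (missing T) \<le> fst st"
proof -
  have "card (elems (snd st)) \<le> card (cub (insert 1 T))"
    using assms by (intro card_mono) (auto simp: counts_def intro!: finite_subset[OF cub_subset_SLm finite_SLm])
  then show ?thesis
    using card_missing[OF assms(1)] assms(2) by (simp add: counts_def)
qed

section \<open>Growing a set whose cube must stay small\<close>

fun all_in :: "trie \<Rightarrow> mat list \<Rightarrow> bool" where
  "all_in H [] \<longleftrightarrow> True"
| "all_in H (y # ys) \<longleftrightarrow> mem y H \<and> all_in H ys"

text \<open>
  The tries in the list are proper subgroups that contain the part chosen so far. If the
  remaining candidates lie in one of them, the set does not generate the group.
\<close>

fun confined :: "trie list \<Rightarrow> mat list \<Rightarrow> bool" where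
  "confined [] ys \<longleftrightarrow> False"
| "confined (H # Hs) ys \<longleftrightarrow> all_in H ys"

text \<open>
  Elements outside the first subgroup come first: after they have all been excluded, the branch
  is \<open>confined\<close>.
\<close>

fun outside_first :: "trie list \<Rightarrow> mat list \<Rightarrow> mat list" where
  "outside_first [] ys = ys"
| "outside_first (H # Hs) ys = filter (\<lambda>y. \<not> mem y H) ys @ filter (\<lambda>y. mem y H) ys"

text \<open>
  Adding \<open>y\<close> brings at least \<open>b\<close> new elements into the cube.
\<close>

definition rejects :: "mat list \<Rightarrow> mat list \<times> trie \<Rightarrow> trie \<Rightarrow> nat \<Rightarrow> mat \<Rightarrow> bool" where
  "rejects S P Q b y \<longleftrightarrow> fst (cubes2 y (squares2 y (y # adj y # S) P) (b, Q)) = 0"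

text \<open>
  Here \<open>s\<close> is the slack for the largest size that can still be reached. A candidate
  that brings the number \<open>fst st\<close> of missing elements down to \<open>s\<close> is
  discarded.
\<close>

definition viable :: "mat list \<Rightarrow> mat list \<times> trie \<Rightarrow> nat \<times> trie \<Rightarrow> nat \<Rightarrow> mat list \<Rightarrow> mat list" where
  "viable S P st s ys = filter (\<lambda>y. \<not> rejects S P (snd st) (fst st - s) y) ys"

text \<open>
  The search decides for one candidate after the other whether its inverse pair belongs to the
  set. In a call, \<open>Hs\<close> are proper subgroups containing \<open>S\<close>, the set
  \<open>S\<close> consists of \<open>1\<close> and \<open>h\<close> pairs, \<open>P\<close>
  lists elements of its square, \<open>st\<close> counts elements of its cube, and
  \<open>ys\<close> are the candidates. The value \<open>True\<close> means that no slow set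
  arises. The first disjunct cuts off branches that cannot generate the group or whose cube is
  already large enough for every size that can still be reached.
\<close>

function explore :: "nat list \<Rightarrow> trie list \<Rightarrow> nat \<Rightarrow> mat list \<Rightarrow> mat list \<times> trie \<Rightarrow> nat \<times> trie \<Rightarrow> mat list \<Rightarrow> bool"
  where
  "explore ts Hs h S P st [] \<longleftrightarrow> confined Hs [] \<or> fst st \<le> thr ts h"
| "explore ts Hs h S P st (y # ys) \<longleftrightarrow>
    (confined Hs (y # ys) \<or> fst st \<le> thr ts (h + length (y # ys))) \<or>
    (let S' = y # adj y # S; Hs' = filter (mem y) Hs; P' = squares2 y S' P; st' = cubes2 y P' st
     in explore ts Hs' (Suc h) S' P' st'
          (outside_first Hs' (viable S' P' st' (thr ts (Suc h + length ys)) ys))) \<and>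
    explore ts Hs h S P st ys"
  by pat_completeness auto

lemma length_outside_first [simp]: "length (outside_first Hs ys) = length ys"
proof (cases Hs)
  case (Cons H Hs')
  then show ?thesis using sum_length_filter_compl[of "\<lambda>y. mem y H" ys] by simp
qed simp

lemma set_outside_first [simp]: "set (outside_first Hs ys) = set ys"
  by (cases Hs) auto

termination
  by (relation "measure (\<lambda>(ts, Hs, h, S, P, st, ys). length ys)") (auto simp: viable_def less_Suc_eq_le)

text \<open>
  The next four definitions cut the equations of \<open>explore\<close> into pieces that share
  subterms and do not use conditionals, so that \<open>explore_code\<close> can be used for
  rewriting.
\<close>

definition visit where
  "visit ts Hs h S P st ys = explore ts Hs h S P st (outside_first Hs (viable S P st (thr ts (h + length ys)) ys))"

definition enlarge where
  "enlarge ts Hs h y S P st ys = visit ts Hs h S P (cubes2 y P st) ys"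

definition explore_and where
  "explore_and b ts Hs h S P st ys \<longleftrightarrow> b \<and> explore ts Hs h S P st ys"

definition explore_or where
  "explore_or b ts Hs h S P st y ys \<longleftrightarrow> b \<or> (enlarge ts (filter (mem y) Hs) (Suc h) y (y # adj y # S)
     (squares2 y (y # adj y # S) P) st ys \<and> explore ts Hs h S P st ys)"

lemma explore_code [code]:
  "explore ts Hs h S P st [] \<longleftrightarrow> confined Hs [] \<or> fst st \<le> thr ts h"
  "explore ts Hs h S P st (y # ys) \<longleftrightarrow>
    explore_or (confined Hs (y # ys) \<or> fst st \<le> thr ts (h + length (y # ys))) ts Hs h S P st y ys"
  "explore_or True ts Hs h S P st y ys \<longleftrightarrow> True"
  "explore_or False ts Hs h S P st y ys \<longleftrightarrow>
    explore_and (enlarge ts (filter (mem y) Hs) (Suc h) y (y # adj y # S) (squares2 y (y # adj y # S) P) st ys)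
      ts Hs h S P st ys"
  "explore_and False ts Hs h S P st ys \<longleftrightarrow> False"
  "explore_and True ts Hs h S P st ys \<longleftrightarrow> explore ts Hs h S P st ys"
  by (auto simp: explore_or_def explore_and_def enlarge_def visit_def Let_def)

text \<open>
  Closed sets are proper subgroups that contain the centre.
\<close>

definition closed :: "mat set \<Rightarrow> bool" where
  "closed H \<longleftrightarrow> H \<subset> SLm \<and> 1 \<in> H \<and> neg1 \<in> H \<and> (\<forall>x\<in>H. \<forall>y\<in>H. x * y \<in> H)"

text \<open>
  Left multiplication by \<open>x\<close> is an injection of the finite set \<open>H\<close>
  into itself, hence onto, and the preimage of \<open>1\<close> is the inverse of
  \<open>x\<close>.
\<close>

lemma closed_adj:
  assumes "closed H" "x \<in> H" shows "adj x \<in> H"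
proof -
  have H: "H \<subseteq> SLm" "1 \<in> H" "\<And>y. y \<in> H \<Longrightarrow> x * y \<in> H"
    using assms by (auto simp: closed_def)
  have x: "x \<in> SLm" using H(1) assms(2) by blast
  have "inj_on ((*) x) H"
    by (rule inj_onI) (simp add: SLm_mult_left_cancel[OF x])
  moreover have "(*) x ` H \<subseteq> H" using H(3) by blast
  ultimately have "(*) x ` H = H"
    by (intro endo_inj_surj finite_subset[OF H(1) finite_SLm])
  then obtain y where "y \<in> H" "x * y = 1"
    using H(2) by (metis imageE)
  then show ?thesis
    using adj_unique[OF x] by simp
qed

text \<open>
  A fixed set whose membership decisions the search has to follow.
\<close>

locale growing =
  fixes ts :: "nat list" and T :: "mat set"
  assumes antimono: "antimono (thr ts)"
    and symm: "symm T" and subset: "T \<subseteq> SLm" and spans: "spans T"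
begin

abbreviation "W \<equiv> insert 1 T"

text \<open>
  The search arguments are consistent with \<open>T\<close>: all of \<open>S\<close> was
  included, and everything excluded so far is outside \<open>T\<close>.
\<close>

definition reached :: "trie list \<Rightarrow> nat \<Rightarrow> mat list \<Rightarrow> mat list \<times> trie \<Rightarrow> nat \<times> trie \<Rightarrow> mat list \<Rightarrow> bool" where
  "reached Hs h S P st ys \<longleftrightarrow>
    set S \<subseteq> W \<and> T \<subseteq> set S \<union> set ys \<union> adj ` set ys \<and> card (T \<inter> set S) \<le> 2 * h \<and> set ys \<subseteq> SLm \<and>
    (\<forall>H\<in>set Hs. closed (elems H) \<and> set S \<subseteq> elems H) \<and>
    set (fst P) \<subseteq> sq W \<and> counts (cub W) 120 st"

lemma symm_W: "symm W" using symm by (rule symm_insert_one)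
lemma W_subset: "W \<subseteq> SLm" using subset by auto
lemma finite_T: "finite T" using subset finite_SLm finite_subset by blast

lemma not_confined:
  assumes "reached Hs h S P st ys" "confined Hs ys" shows False
proof -
  obtain H Hs' where Hs: "Hs = H # Hs'" using assms(2) by (cases Hs) auto
  have c: "closed (elems H)" "set S \<subseteq> elems H" using assms(1) Hs by (auto simp: reached_def)
  have all: "all_in H ys \<Longrightarrow> set ys \<subseteq> SLm \<Longrightarrow> set ys \<subseteq> elems H"
    by (induction ys) (auto simp: mem_elems)
  have "set ys \<subseteq> elems H" using assms Hs all by (auto simp: reached_def)
  then have "adj ` set ys \<subseteq> elems H" "set ys \<subseteq> elems H"
    using closed_adj[OF c(1)] by blast+
  moreover have "T \<subseteq> set S \<union> set ys \<union> adj ` set ys"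
    using assms(1) by (simp add: reached_def)
  ultimately have "T \<subseteq> elems H"
    using c(2) by blast
  then have "SLm \<subseteq> elems H"
    using spans[unfolded spans_def, rule_format, of "elems H"] c(1) by (auto simp: closed_def)
  then show False using c(1) by (auto simp: closed_def)
qed

lemma pairs_le:
  assumes "reached Hs h S P st ys" shows "pairs T \<le> h + length ys"
proof -
  have "T \<subseteq> (T \<inter> set S) \<union> (set ys \<union> adj ` set ys)" using assms by (auto simp: reached_def)
  then have "card T \<le> card ((T \<inter> set S) \<union> (set ys \<union> adj ` set ys))"
    by (intro card_mono) (auto simp: finite_T)
  also have "\<dots> \<le> card (T \<inter> set S) + (card (set ys) + card (adj ` set ys))"
    by (meson card_Un_le add_left_mono order_trans)
  also have "\<dots> \<le> 2 * h + (length ys + length ys)"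
    using assms card_image_le[of "set ys" adj] card_length[of ys] by (auto simp: reached_def intro!: add_mono)
  finally show ?thesis by (simp add: pairs_def)
qed

lemma room_le:
  assumes "reached Hs h S P st ys" "fst st \<le> thr ts (h + length ys)"
  shows "card (missing T) \<le> thr ts (pairs T)"
proof -
  have "card (missing T) \<le> fst st"
    using card_missing_le subset assms(1) by (simp add: reached_def)
  also have "\<dots> \<le> thr ts (h + length ys)" by (rule assms(2))
  also have "\<dots> \<le> thr ts (pairs T)" by (rule antimonoD[OF antimono pairs_le[OF assms(1)]])
  finally show ?thesis .
qed

text \<open>
  If a rejected candidate belonged to \<open>T\<close>, the cube would be large enough for all
  sizes up to the largest one that can still be reached, in particular for the size of
  \<open>T\<close>.
\<close>

lemma rejected:
  assumes r: "reached Hs h S P st ys" and y: "y \<in> T"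
    and rej: "rejects S P (snd st) (fst st - thr ts (h + length ys)) y"
  shows "card (missing T) \<le> thr ts (pairs T)"
proof -
  let ?s = "thr ts (h + length ys)" and ?Q = "snd st"
  define st' where "st' = cubes2 y (squares2 y (y # adj y # S) P) (fst st - ?s, ?Q)"
  have c: "counts (cub W) (fst st - ?s + card (elems ?Q)) (fst st - ?s, ?Q)" "120 \<le> fst st + card (elems ?Q)"
    using r by (auto simp: reached_def counts_def)
  have "set (fst (squares2 y (y # adj y # S) P)) \<subseteq> sq W"
    using r y symm_W by (intro set_squares2) (auto simp: reached_def symm_def)
  then have "counts (cub W) (fst st - ?s + card (elems ?Q)) st'"
    unfolding st'_def using c(1) y symm_W W_subset by (intro counts_cubes2) auto
  moreover have "fst st' = 0" using rej by (simp add: rejects_def st'_def)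
  ultimately have "counts (cub W) 120 (?s, snd st')" using c(2) by (auto simp: counts_def)
  then have "card (missing T) \<le> ?s" using card_missing_le[OF subset] by fastforce
  also have "\<dots> \<le> thr ts (pairs T)" by (rule antimonoD[OF antimono pairs_le[OF r]])
  finally show ?thesis .
qed

lemma reached_viable:
  assumes r: "reached Hs h S P st ys" and "\<not> card (missing T) \<le> thr ts (pairs T)"
  shows "reached Hs h S P st (outside_first Hs (viable S P st (thr ts (h + length ys)) ys))"
proof -
  have *: "y \<in> T \<Longrightarrow> y \<in> set ys \<Longrightarrow> y \<in> set (viable S P st (thr ts (h + length ys)) ys)" for y
    using rejected[OF r, of y] assms(2) by (auto simp: viable_def)
  have "t \<in> set S \<union> set (viable S P st (thr ts (h + length ys)) ys) \<union> adj ` set (viable S P st (thr ts (h + length ys)) ys)"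
    if t: "t \<in> T" for t
  proof -
    consider "t \<in> set S" | "t \<in> set ys" | y where "y \<in> set ys" "t = adj y"
      using t r by (auto simp: reached_def)
    then show ?thesis
    proof cases
      case 3
      then have "y \<in> T" using t symm by (metis adj_adj symm_def)
      then show ?thesis using * 3 by auto
    qed (use * t in auto)
  qed
  then show ?thesis
    using r unfolding reached_def by (auto simp: viable_def)
qed

lemma reached_include:
  assumes r: "reached Hs h S P st (y # ys)" and y: "y \<in> T"
  shows "reached (filter (mem y) Hs) (Suc h) (y # adj y # S) (squares2 y (y # adj y # S) P)
    (cubes2 y (squares2 y (y # adj y # S) P) st) ys"
proof -
  have adj: "adj y \<in> T" using y symm by (simp add: symm_def)
  have sq: "set (fst (squares2 y (y # adj y # S) P)) \<subseteq> sq W"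
    using r y adj symm_W by (intro set_squares2) (auto simp: reached_def)
  have "card (T \<inter> set (y # adj y # S)) \<le> card ({y, adj y} \<union> (T \<inter> set S))"
    by (intro card_mono) (auto simp: finite_T)
  also have "\<dots> \<le> card {y, adj y} + card (T \<inter> set S)" by (rule card_Un_le)
  also have "\<dots> \<le> 2 * Suc h"
    using r card_length[of "[y, adj y]"] by (simp add: reached_def)
  finally have card: "card (T \<inter> set (y # adj y # S)) \<le> 2 * Suc h" .
  have "\<forall>H\<in>set (filter (mem y) Hs). closed (elems H) \<and> set (y # adj y # S) \<subseteq> elems H"
    using r closed_adj by (auto simp: reached_def mem_elems)
  moreover have "counts (cub W) 120 (cubes2 y (squares2 y (y # adj y # S) P) st)"
    using r sq y symm_W W_subset by (intro counts_cubes2) (auto simp: reached_def)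
  ultimately show ?thesis
    using r y adj sq card unfolding reached_def by auto
qed

lemma reached_exclude:
  assumes r: "reached Hs h S P st (y # ys)" and y: "y \<notin> T"
  shows "reached Hs h S P st ys"
proof -
  have "adj y \<notin> T" using y symm by (metis adj_adj symm_def)
  then show ?thesis using r y unfolding reached_def by auto
qed

text \<open>
  At each candidate the search has a branch that agrees with \<open>T\<close>, and following
  these branches leads to a cut-off that bounds the number of missing elements.
\<close>

lemma explore_sound:
  "explore us Hs h S P st ys \<Longrightarrow> us = ts \<Longrightarrow> reached Hs h S P st ys \<Longrightarrow> card (missing T) \<le> thr ts (pairs T)"
proof (induction us Hs h S P st ys rule: explore.induct)
  case (1 us Hs h S P st)
  then show ?case using not_confined[of Hs h S P st "[]"] room_le[of Hs h S P st "[]"] by auto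
next
  case (2 us Hs h S P st y ys)
  show ?case
  proof (rule ccontr)
    assume neg: "\<not> card (missing T) \<le> thr ts (pairs T)"
    have nb: "\<not> (confined Hs (y # ys) \<or> fst st \<le> thr us (h + length (y # ys)))"
      using not_confined[OF 2(5)] room_le[OF 2(5)] neg 2(4) by auto
    show False
    proof (cases "y \<in> T")
      case True
      show False
        using 2(1)[OF refl refl refl refl] 2(3) nb 2(4) reached_viable[OF reached_include[OF 2(5) True] neg] neg
        by (auto simp: Let_def)
    next
      case False
      show False
        using 2(2) 2(3) nb 2(4) reached_exclude[OF 2(5) False] neg by (auto simp: Let_def)
    qed
  qed
qed

end

text \<open>
  One element of each of the \<open>59\<close> inverse pairs of noncentral elements. The order
  of the representatives affects only the sizes of the search trees.
\<close>

definition reps :: "mat list" where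
  "reps = [
   M F3 F3 F2 F4, M F4 F2 F0 F4, M F1 F4 F3 F3, M F3 F2 F3 F4, M F0 F1 F4 F2, M F2 F2 F1 F4,
   M F0 F2 F2 F1, M F0 F1 F4 F1, M F0 F2 F2 F0, M F0 F4 F1 F1, M F0 F2 F2 F4, M F0 F4 F1 F2,
   M F1 F2 F3 F2, M F3 F1 F3 F3, M F2 F2 F4 F2, M F0 F4 F1 F4, M F1 F2 F0 F1, M F1 F1 F2 F3,
   M F2 F3 F4 F4, M F3 F2 F4 F3, M F1 F3 F4 F3, M F3 F1 F1 F4, M F1 F2 F4 F4, M F1 F1 F3 F4,
   M F1 F0 F1 F1, M F1 F0 F2 F1, M F4 F0 F1 F4, M F0 F1 F4 F3, M F0 F2 F2 F2, M F3 F4 F4 F4,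
   M F0 F3 F3 F2, M F1 F1 F0 F1, M F4 F1 F0 F4, M F0 F3 F3 F3, M F1 F4 F4 F2, M F0 F3 F3 F4,
   M F2 F1 F3 F2, M F1 F1 F1 F2, M F0 F1 F4 F4, M F2 F1 F2 F4, M F2 F3 F0 F3, M F0 F3 F3 F1,
   M F2 F4 F0 F3, M F2 F0 F0 F3, M F0 F1 F4 F0, M F1 F3 F1 F4, M F0 F4 F1 F3, M F0 F2 F2 F3,
   M F2 F4 F3 F4, M F4 F0 F2 F4, M F1 F4 F2 F4, M F2 F1 F0 F3, M F2 F0 F1 F3, M F2 F0 F4 F3,
   M F2 F0 F2 F3, M F1 F2 F1 F3, M F2 F2 F0 F3, M F1 F3 F2 F2, M F2 F0 F3 F3]"

text \<open>
  The same pairs in an order that suits the search for sets avoiding an element of order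
  \<open>4\<close>.
\<close>

definition reps4 :: "mat list" where
  "reps4 = [
   M F2 F0 F1 F3, M F2 F4 F0 F3, M F0 F3 F3 F3, M F1 F0 F2 F1, M F1 F1 F0 F1, M F4 F1 F0 F4,
   M F3 F3 F2 F4, M F2 F0 F3 F3, M F0 F4 F1 F3, M F4 F2 F0 F4, M F0 F2 F2 F1, M F3 F1 F1 F4,
   M F2 F1 F3 F2, M F1 F1 F3 F4, M F1 F0 F1 F1, M F0 F1 F4 F2, M F3 F1 F3 F3, M F4 F0 F1 F4,
   M F1 F2 F1 F3, M F2 F1 F2 F4, M F3 F2 F3 F4, M F0 F2 F2 F3, M F0 F4 F1 F2, M F0 F3 F3 F2,
   M F0 F1 F4 F1, M F1 F2 F3 F2, M F1 F1 F2 F3, M F1 F3 F2 F2, M F2 F2 F1 F4, M F2 F0 F4 F3,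
   M F3 F4 F4 F4, M F1 F1 F1 F2, M F2 F3 F0 F3, M F1 F4 F4 F2, M F2 F4 F3 F4, M F1 F4 F2 F4,
   M F1 F4 F3 F3, M F0 F1 F4 F0, M F3 F2 F4 F3, M F0 F2 F2 F2, M F0 F1 F4 F3, M F2 F0 F0 F3,
   M F0 F3 F3 F1, M F0 F4 F1 F1, M F2 F2 F4 F2, M F0 F1 F4 F4, M F4 F0 F2 F4, M F2 F0 F2 F3,
   M F2 F1 F0 F3, M F1 F2 F0 F1, M F2 F3 F4 F4, M F2 F2 F0 F3, M F0 F2 F2 F0, M F1 F2 F4 F4,
   M F1 F3 F1 F4, M F0 F2 F2 F4, M F0 F4 F1 F4, M F1 F3 F4 F3, M F0 F3 F3 F4]"

definition represents :: "mat list \<Rightarrow> bool" where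
  "represents rs \<longleftrightarrow> set rs \<subseteq> SLm \<and> SLm \<subseteq> {1, neg1} \<union> set rs \<union> adj ` set rs"

lemma all_in_iff: "all_in H xs \<longleftrightarrow> (\<forall>x\<in>set xs. mem x H)"
  by (induction xs) auto

lemma representsI:
  assumes rs: "list_all (\<lambda>x. dt x = 1) rs"
    and all: "all_in (inss [1, neg1] (inss rs (inss (map adj rs) Empty))) sl"
  shows "represents rs"
proof -
  have "set rs \<subseteq> SLm" using rs by (auto simp: list_all_iff SLm_def)
  moreover from this have "set (map adj rs) \<subseteq> SLm" "set [1, neg1] \<subseteq> SLm" by auto
  ultimately have "elems (inss [1, neg1] (inss rs (inss (map adj rs) Empty))) = {1, neg1} \<union> set rs \<union> adj ` set rs"
    by (simp only: elems_inss) auto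
  with \<open>set rs \<subseteq> SLm\<close> show ?thesis
    using all unfolding represents_def all_in_iff set_sl by (auto simp: mem_elems)
qed

lemma represents_reps: "represents reps" "represents reps4"
  by (rule representsI; code_simp)+

lemma stabD: "P \<in> set (stab G) \<Longrightarrow> dt P \<noteq> 0"
  by (auto simp: stab_def dt_pgl)

lemma stab_cases: "P \<in> set (stab G) \<Longrightarrow> g \<in> set G \<Longrightarrow> cj P g \<in> set G \<or> adj (cj P g) \<in> set G"
  by (auto simp: stab_def list_all_iff)

text \<open>
  A symmetric set contains an element iff it contains the representative of its pair.
\<close>

lemma representsD:
  assumes "represents rs" "T \<subseteq> SLm - {1, neg1}" "symm T" "t \<in> T"
  obtains y where "y \<in> set rs" "y \<in> T" "t = y \<or> t = adj y"
proof -
  have "t \<in> set rs \<union> adj ` set rs" using assms unfolding represents_def by blast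
  then show ?thesis using that assms(3,4) symm_adj_iff by blast
qed

definition normal :: "mat list \<Rightarrow> mat \<Rightarrow> bool" where
  "normal A p \<longleftrightarrow> list_all (\<lambda>a. p * a * adj p \<in> set A) A"

definition normaliser :: "mat list \<Rightarrow> trie" where
  "normaliser A = inss (filter (normal A) sl) Empty"

lemma neg1_neg1: "neg1 * neg1 = 1"
  by (simp add: neg1_def one_mat_def)

text \<open>
  Properness is tested on the computed trie.
\<close>

lemma closed_normaliser:
  assumes "\<not> all_in (normaliser A) sl" shows "closed (elems (normaliser A))"
proof -
  have el: "elems (normaliser A) = {p \<in> SLm. normal A p}"
    unfolding normaliser_def by (subst elems_inss) (auto simp: set_sl)
  have "normal A (p * q)" if "normal A p" "normal A q" for p q
  proof -
    have "p * (q * a * adj q) * adj p \<in> set A" if "a \<in> set A" for a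
      using that \<open>normal A p\<close> \<open>normal A q\<close> by (simp add: normal_def list_all_iff)
    then show ?thesis by (simp add: normal_def list_all_iff adj_mult mult.assoc)
  qed
  moreover have "normal A 1" by (simp add: normal_def list_all_iff)
  moreover have "normal A neg1"
  proof -
    have "neg1 * a * adj neg1 = a" for a
      using neg1_commutes[of a] by (simp add: mult.assoc neg1_neg1)
    then show ?thesis by (simp add: normal_def list_all_iff)
  qed
  moreover have "elems (normaliser A) \<noteq> SLm"
    using assms by (auto simp: all_in_iff set_sl mem_elems)
  ultimately show ?thesis unfolding closed_def el by auto
qed

text \<open>
  The normalisers of these families are the maximal subgroups of \<open>SL(2,5)\<close>: those
  of the subgroups of order \<open>3\<close> (order \<open>12\<close>, trace \<open>F4\<close>),
  of order \<open>5\<close> (order \<open>20\<close>, trace \<open>F2\<close>), and of the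
  quaternion subgroups of order \<open>8\<close> (order \<open>24\<close>). The six elements of
  order \<open>4\<close> of a quaternion group are those elements of trace \<open>0\<close> that
  commute with one of them up to inversion. The proofs use only that normalisers are subgroups;
  maximality keeps the search short.
\<close>

definition families :: "mat list list" where
  "families = map (\<lambda>x. [x, adj x]) (filter (\<lambda>x. tr x = F4) reps @ filter (\<lambda>x. tr x = F2) reps)
    @ map (\<lambda>x. filter (\<lambda>y. tr y = F0 \<and> (y * x = x * y \<or> y * x = adj x * y)) sl) (filter (\<lambda>x. tr x = F0) reps)"

definition subgroups :: "mat \<Rightarrow> trie list" where
  "subgroups r = map normaliser (filter (\<lambda>A. normal A r) families)"

text \<open>
  The search below \<open>{r, y}\<close> and inverses, with all elements of \<open>D\<close>
  excluded.
\<close>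

definition grow_test :: "mat \<Rightarrow> trie list \<Rightarrow> mat list \<times> trie \<Rightarrow> nat \<times> trie \<Rightarrow> mat \<Rightarrow> trie \<Rightarrow> bool" where
  "grow_test r Hs P st y D \<longleftrightarrow>
    enlarge small_slacks (filter (mem y) Hs) 2 y [y, adj y, r, adj r, 1] (squares2 y [y, adj y, r, adj r, 1] P) st
      (filter (\<lambda>z. \<not> mem z (ins r (ins y D))) reps)"

text \<open>
  Every element outside the subgroup \<open>H\<close> has been struck out.
\<close>

definition swept :: "trie \<Rightarrow> trie \<Rightarrow> bool" where
  "swept H D \<longleftrightarrow> list_all (\<lambda>y. mem y H \<or> mem y D) reps"

fun grow_from :: "mat \<Rightarrow> trie list \<Rightarrow> trie \<Rightarrow> mat list \<times> trie \<Rightarrow> nat \<times> trie \<Rightarrow> bool" where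
  "grow_from r [] D P st = False"
| "grow_from r (H # Hs) D P st =
    (list_all (\<lambda>K. mem r K \<and> \<not> all_in K sl) (H # Hs) \<and>
     swept H (sweep (grow_test r (H # Hs) P st) (stab [r]) (filter (\<lambda>y. \<not> mem y H) reps) D))"

definition start_squares :: "mat \<Rightarrow> mat list \<times> trie" where
  "start_squares r = squares2 r [r, adj r, 1] ([1], Empty)"

text \<open>
  The check that no slow set with at most eleven pairs contains \<open>r\<close>, provided that
  none contains an element of \<open>prev\<close>.
\<close>

definition kills :: "mat \<Rightarrow> mat list \<Rightarrow> bool" where
  "kills r prev \<longleftrightarrow> r \<in> set reps \<and>
    grow_from r (subgroups r) (orbits pgl prev Empty) (start_squares r) (cubes2 r (start_squares r) (120, Empty))"

context growing
begin

lemma enlarge_sound: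
  assumes "reached Hs h S P st (y # ys)" "y \<in> T"
    and "enlarge ts (filter (mem y) Hs) (Suc h) y (y # adj y # S) (squares2 y (y # adj y # S) P) st ys"
  shows "card (missing T) \<le> thr ts (pairs T)"
  using explore_sound[OF _ refl reached_viable[OF reached_include[OF assms(1,2)]]] assms(3)
  unfolding enlarge_def visit_def by blast

end

text \<open>
  Eleven pairs is the range in which the search for growing sets is effective.
\<close>

definition small_slow :: "mat set set" where
  "small_slow = {T. slow T \<and> card T \<le> 22}"

lemma small_slow_uncj: "dt P \<noteq> 0 \<Longrightarrow> T \<in> small_slow \<Longrightarrow> uncj P ` T \<in> small_slow"
  by (simp add: small_slow_def slow_image_uncj card_image_uncj)

lemma not_small_slow:
  assumes "T \<in> small_slow" shows "\<not> card (missing T) \<le> thr small_slacks (pairs T)"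
proof -
  have "card T \<le> 22" using assms by (simp add: small_slow_def)
  then have "pairs T < 12" unfolding pairs_def by presburger
  then have "pairs T < length small_slacks" by (simp add: small_slacks_def)
  then show ?thesis
    using assms by (simp add: small_slow_def slow_def slack_def thr_append)
qed

lemma growing_small_slow: "T \<in> small_slow \<Longrightarrow> growing small_slacks T"
  by unfold_locales (auto simp: small_slow_def slow_def small_slacks_def intro!: antimono_thr)

text \<open>
  A generating set that contains \<open>r\<close> also contains an element \<open>y\<close>
  outside the first subgroup \<open>H\<close> through \<open>r\<close>. Up to the stabiliser of
  the pair of \<open>r\<close>, each such \<open>y\<close> has been tested.
\<close>

lemma kills_dead:
  assumes kills: "kills r prev" and prev: "set prev \<subseteq> SLm" "\<forall>x\<in>set prev. dead small_slow x"
  shows "dead small_slow r"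
proof (rule deadI, rule notI)
  fix T assume T: "T \<in> small_slow" "r \<in> T"
  let ?V = "{T \<in> small_slow. r \<in> T}"
  let ?P = "start_squares r" and ?st = "cubes2 r (start_squares r) (120, Empty)"
  let ?D = "orbits pgl prev Empty"
  obtain H Hs where Hs: "subgroups r = H # Hs"
    using kills by (cases "subgroups r") (auto simp: kills_def)
  have grow: "\<forall>K\<in>set (H # Hs). mem r K \<and> \<not> all_in K sl"
    "swept H (sweep (grow_test r (H # Hs) ?P ?st) (stab [r]) (filter (\<lambda>y. \<not> mem y H) reps) ?D)"
    using kills by (simp_all add: kills_def Hs list_all_iff)
  have reps_SLm: "set reps \<subseteq> SLm" using represents_reps(1) by (simp add: represents_def)
  have r: "r \<in> SLm" using kills reps_SLm by (auto simp: kills_def)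
  have closed: "closed (elems K)" "r \<in> elems K" if "K \<in> set (H # Hs)" for K
  proof -
    have "K \<in> set (subgroups r)" using that Hs by simp
    then show "closed (elems K)" using that grow(1) closed_normaliser by (auto simp: subgroups_def)
    show "r \<in> elems K" using that grow(1) r by (auto simp: mem_elems)
  qed
  interpret all: conj_class small_slow pgl
    by unfold_locales (auto simp: small_slow_uncj dt_pgl, auto simp: small_slow_def slow_def)
  interpret V: conj_class ?V "stab [r]"
  proof
    fix P T assume P: "P \<in> set (stab [r])" and T: "T \<in> ?V"
    have "cj P r \<in> T" using stab_cases[OF P, of r] T symm_adj_iff[of T "cj P r"] adj_adj
      by (auto simp: small_slow_def slow_def symm_def)
    then have "r \<in> uncj P ` T" using uncj_cj[OF stabD[OF P], of r] by (metis imageI)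
    then show "uncj P ` T \<in> ?V" using T small_slow_uncj[OF stabD[OF P]] by simp
  qed (auto simp: stabD small_slow_def slow_def)
  have D: "\<forall>x\<in>elems ?D. dead ?V x"
    using all.dead_orbits[OF prev, of Empty] by (auto simp: dead_def)
  have test: "dead ?V y"
    if y: "y \<in> set (filter (\<lambda>y. \<not> mem y H) reps)" and t: "grow_test r (H # Hs) ?P ?st y D"
      and D: "\<forall>x\<in>elems D. dead ?V x" for y D
  proof (rule deadI, rule notI)
    fix T assume TV: "T \<in> ?V" and yT: "y \<in> T"
    then have T: "T \<in> small_slow" "r \<in> T" by auto
    interpret growing small_slacks T by (rule growing_small_slow[OF T(1)])
    have T_sub: "T \<subseteq> SLm - {1, neg1}" using T by (simp add: small_slow_def slow_def)
    have adj_r: "adj r \<in> T" using T(2) symm by (simp add: symm_def)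
    let ?ys = "filter (\<lambda>z. \<not> mem z (ins r (ins y D))) reps"
    have sq: "set (fst ?P) \<subseteq> sq W"
      unfolding start_squares_def using T(2) adj_r symm_W
      by (intro set_squares2) (auto simp: sq_def intro!: exI[of _ 1])
    have counts: "counts (cub W) 120 ?st"
      using T(2) symm_W W_subset sq by (intro counts_cubes2) (auto simp: counts_def)
    have ins: "elems (ins r (ins y D)) = insert r (insert y (elems D))"
      using r y reps_SLm by (subst elems_ins; (subst elems_ins)?) auto
    have cover: "t \<in> {1, r, adj r, y, adj y} \<union> set ?ys \<union> adj ` set ?ys" if t: "t \<in> T" for t
    proof -
      obtain z where z: "z \<in> set reps" "z \<in> T" "t = z \<or> t = adj z"
        using representsD[OF represents_reps(1) T_sub symm t] .
      have "z \<notin> elems D" using D z(2) TV by (auto simp: dead_def)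
      then have "z \<in> {r, y} \<or> z \<in> set ?ys"
        using z(1) reps_SLm ins by (auto simp: mem_elems)
      then show ?thesis using z(3) by auto
    qed
    have "T \<inter> {r, adj r, 1} \<subseteq> {r, adj r}" using T_sub by auto
    then have "card (T \<inter> {r, adj r, 1}) \<le> card {r, adj r}" by (intro card_mono) auto
    also have "\<dots> \<le> 2 * 1" using card_length[of "[r, adj r]"] by simp
    finally have "card (T \<inter> {r, adj r, 1}) \<le> 2 * 1" .
    then have "reached (H # Hs) 1 [r, adj r, 1] ?P ?st (y # ?ys)"
      using T(2) adj_r cover y reps_SLm closed closed_adj sq counts
      unfolding reached_def by (auto simp: closed_def)
    then have "card (missing T) \<le> thr small_slacks (pairs T)"
      using t yT by (intro enlarge_sound) (auto simp: grow_test_def numeral_2_eq_2)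
    then show False using not_small_slow[OF T(1)] by blast
  qed
  have dead: "\<forall>x\<in>elems (sweep (grow_test r (H # Hs) ?P ?st) (stab [r]) (filter (\<lambda>y. \<not> mem y H) reps) ?D). dead ?V x"
    using reps_SLm by (intro V.dead_sweep test D) auto
  have "T \<subseteq> elems H"
  proof
    fix t assume t: "t \<in> T"
    have sT: "symm T" "T \<subseteq> SLm - {1, neg1}" using T by (simp_all add: small_slow_def slow_def)
    obtain z where z: "z \<in> set reps" "z \<in> T" "t = z \<or> t = adj z"
      using representsD[OF represents_reps(1) sT(2,1) t] .
    have "\<not> dead ?V z" using z(2) T by (auto simp: dead_def)
    moreover have "z \<in> SLm" using z(1) reps_SLm by blast
    ultimately have "z \<in> elems H"
      using grow(2) dead z(1) unfolding swept_def list_all_iff by (meson mem_elems)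
    then show "t \<in> elems H" using z(3) closed_adj[OF closed(1)[of H]] by auto
  qed
  moreover have "closed (elems H)" using closed(1) by simp
  moreover have "spans T" using T by (simp add: small_slow_def slow_def)
  ultimately show False
    unfolding spans_def closed_def by blast
qed

section \<open>Searching for sets that avoid a given product\<close>

text \<open>
  Suppose that \<open>x\<close> and \<open>s\<close> are in a symmetric set. If \<open>y\<close>
  is one of the six inserted elements, then \<open>g\<close> is a product of \<open>y\<close>
  with the inverses of \<open>x\<close> and \<open>s\<close> in some order. The arguments
  \<open>gx\<close> and \<open>xg\<close> hold \<open>g * x\<close> and \<open>x * g\<close>.
\<close>

fun spots :: "mat \<Rightarrow> mat \<Rightarrow> mat \<Rightarrow> mat \<Rightarrow> mat list \<Rightarrow> trie \<Rightarrow> trie" where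
  "spots g x gx xg [] F = F"
| "spots g x gx xg (s # S) F = spots g x gx xg S
     (inss [g * (x * s), x * s * g] (inss [g * (s * x), s * x * g] (inss [xg * s, s * gx] F)))"

text \<open>
  The elements that may not join a symmetric set containing \<open>x\<close> and
  \<open>S\<close> if its cube is to avoid \<open>G\<close>. They are computed with
  \<open>x\<close> and with its inverse.
\<close>

fun forb :: "mat list \<Rightarrow> mat \<Rightarrow> mat list \<Rightarrow> trie" where
  "forb [] x S = Empty"
| "forb (g # G) x S = spots g x (g * x) (x * g) S (spots g (adj x) (g * adj x) (adj x * g) S (forb G x S))"

definition clear :: "trie \<Rightarrow> mat \<Rightarrow> bool" where
  "clear F y \<longleftrightarrow> \<not> mem y F \<and> \<not> mem (adj y) F"

fun hits :: "trie \<Rightarrow> mat list \<Rightarrow> bool" where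
  "hits F [] \<longleftrightarrow> False"
| "hits F (s # S) \<longleftrightarrow> mem s F \<or> hits F S"

text \<open>
  Fewer than \<open>n\<close> cells are nonempty.
\<close>

fun short :: "nat \<Rightarrow> mat list list \<Rightarrow> bool" where
  "short 0 cs = False"
| "short (Suc n) [] = True"
| "short (Suc n) ([] # cs) = short (Suc n) cs"
| "short (Suc n) ((x # xs) # cs) = short n cs"

fun all_squares :: "mat list \<Rightarrow> mat list \<Rightarrow> mat list \<times> trie \<Rightarrow> mat list \<times> trie" where
  "all_squares S [] P = P"
| "all_squares S (x # xs) P = all_squares S xs (squares x S P)"

fun all_cubes :: "mat list \<Rightarrow> mat list \<Rightarrow> nat \<times> trie \<Rightarrow> nat \<times> trie" where
  "all_cubes ps [] st = st"
| "all_cubes ps (x # xs) st = all_cubes ps xs (cubes x ps st)"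

text \<open>
  For a list of \<open>1\<close> and \<open>h\<close> pairs, half of the length rounded down is
  \<open>h\<close>.
\<close>

definition few_missing :: "mat list \<Rightarrow> bool" where
  "few_missing S \<longleftrightarrow>
    fst (all_cubes (fst (all_squares S S ([], Empty))) S (120, Empty)) \<le> slack (length S div 2)"

text \<open>
  The search decides membership of the elements in the cells one after the other. At least
  \<open>n\<close> further pairs are needed, and a cell can provide only one. When no candidates
  are left, the set is known completely and its cube is counted.
\<close>

function search :: "mat list \<Rightarrow> mat list \<Rightarrow> nat \<Rightarrow> mat list list \<Rightarrow> bool" where
  "search G S n [] \<longleftrightarrow> n \<noteq> 0 \<or> few_missing S"
| "search G S n ([] # cs) \<longleftrightarrow> search G S n cs"
| "search G S n ((x # xs) # cs) \<longleftrightarrow>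
    short n ((x # xs) # cs) \<or>
    (hits (forb G x (x # adj x # S)) (x # adj x # S) \<or>
     search G (x # adj x # S) (n - 1) (map (filter (clear (forb G x (x # adj x # S)))) cs)) \<and>
    search G S n (xs # cs)"
  by pat_completeness auto

lemma sum_length_filter: "sum_list (map length (map (filter p) cs)) \<le> sum_list (map length cs)"
  by (induction cs) (auto intro: add_mono)

termination
proof (relation "measure (\<lambda>(G, S, n, cs). length cs + sum_list (map length cs))", goal_cases)
  case (3 G S n x xs cs)
  then show ?case using sum_length_filter[of "clear (forb G x (x # adj x # S))" cs] by simp
qed auto

text \<open>
  As for \<open>explore\<close>, the equations of \<open>search\<close> are restated for
  rewriting.
\<close>

definition enter :: "mat list \<Rightarrow> mat list \<Rightarrow> nat \<Rightarrow> trie \<Rightarrow> mat list list \<Rightarrow> bool" where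
  "enter G S n F cs \<longleftrightarrow> hits F S \<or> search G S n (map (filter (clear F)) cs)"

definition enter_or :: "bool \<Rightarrow> mat list \<Rightarrow> mat list \<Rightarrow> nat \<Rightarrow> trie \<Rightarrow> mat list list \<Rightarrow> bool" where
  "enter_or b G S n F cs \<longleftrightarrow> b \<or> search G S n (map (filter (clear F)) cs)"

definition search_and :: "bool \<Rightarrow> mat list \<Rightarrow> mat list \<Rightarrow> nat \<Rightarrow> mat list list \<Rightarrow> bool" where
  "search_and b G S n cs \<longleftrightarrow> b \<and> search G S n cs"

definition search_or :: "bool \<Rightarrow> mat list \<Rightarrow> mat list \<Rightarrow> nat \<Rightarrow> mat \<Rightarrow> mat list \<Rightarrow> mat list list \<Rightarrow> bool" where
  "search_or b G S n x xs cs \<longleftrightarrow>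
    b \<or> (enter G (x # adj x # S) (n - 1) (forb G x (x # adj x # S)) cs \<and> search G S n (xs # cs))"

lemma search_code [code]:
  "search G S n [] \<longleftrightarrow> n \<noteq> 0 \<or> few_missing S"
  "search G S n ([] # cs) \<longleftrightarrow> search G S n cs"
  "search G S n ((x # xs) # cs) \<longleftrightarrow> search_or (short n ((x # xs) # cs)) G S n x xs cs"
  "search_or True G S n x xs cs \<longleftrightarrow> True"
  "search_or False G S n x xs cs \<longleftrightarrow>
    search_and (enter G (x # adj x # S) (n - 1) (forb G x (x # adj x # S)) cs) G S n (xs # cs)"
  "search_and False G S n cs \<longleftrightarrow> False"
  "search_and True G S n cs \<longleftrightarrow> search G S n cs"
  "enter G S n F cs \<longleftrightarrow> enter_or (hits F S) G S n F cs"
  "enter_or True G S n F cs \<longleftrightarrow> True"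
  "enter_or False G S n F cs \<longleftrightarrow> search G S n (map (filter (clear F)) cs)"
  by (auto simp: search_or_def search_and_def enter_def enter_or_def)

lemma [termination_simp]: "length (filter p xs) < Suc (length xs)"
  by (simp add: less_Suc_eq_le)

text \<open>
  A cell that starts with the first candidate and consists of candidates that exclude each other
  in the presence of \<open>1\<close>.
\<close>

fun clique :: "mat list \<Rightarrow> mat list \<Rightarrow> mat list" where
  "clique G [] = []"
| "clique G (y # ys) = y # clique G (filter (\<lambda>z. \<not> clear (forb G y [y, adj y, 1]) z) ys)"

fun greedy :: "mat list \<Rightarrow> mat list \<Rightarrow> mat list list" where
  "greedy G [] = []"
| "greedy G (y # ys) =
    clique G (y # ys) # greedy G (filter (\<lambda>z. \<not> mem z (inss (clique G (y # ys)) Empty)) ys)"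

text \<open>
  Elements that are excluded by themselves and \<open>1\<close> are dropped before cells are
  formed.
\<close>

definition cells :: "mat list \<Rightarrow> mat list \<Rightarrow> mat list list" where
  "cells rs G = greedy G (filter (\<lambda>x. \<not> hits (forb G x [x, adj x, 1]) [x, adj x, 1]) rs)"

definition remaining :: "trie \<Rightarrow> mat list list \<Rightarrow> mat list list" where
  "remaining D cs = map (filter (\<lambda>y. \<not> mem y D)) cs"

definition avoid_test :: "mat list \<Rightarrow> nat \<Rightarrow> mat list list \<Rightarrow> mat \<Rightarrow> trie \<Rightarrow> bool" where
  "avoid_test G n cs x D \<longleftrightarrow>
    enter G [x, adj x, 1] (n - 1) (forb G x [x, adj x, 1]) (remaining (ins x D) cs)"

definition avoid_from :: "mat list \<Rightarrow> nat \<Rightarrow> mat list \<Rightarrow> mat list list \<Rightarrow> bool" where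
  "avoid_from G n rs cs \<longleftrightarrow> search G [1] n (remaining (sweep (avoid_test G n cs) (stab G) rs Empty) cs)"

text \<open>
  The check that every slow set with at least \<open>n\<close> pairs has an element of
  \<open>G\<close> in its cube.
\<close>

definition unavoidable :: "mat list \<Rightarrow> mat list \<Rightarrow> nat \<Rightarrow> bool" where
  "unavoidable rs G n \<longleftrightarrow> avoid_from G n rs (cells rs G)"

lemma all_clear: "hits F S \<longleftrightarrow> (\<exists>s\<in>set S. mem s F)"
  by (induction S) auto

lemma elems_spots:
  "g \<in> SLm \<Longrightarrow> x \<in> SLm \<Longrightarrow> set S \<subseteq> SLm \<Longrightarrow> y \<in> elems (spots g x (g * x) (x * g) S F) \<Longrightarrow>
    y \<in> elems F \<or> (\<exists>s\<in>set S. y \<in> {g * (x * s), x * s * g, g * (s * x), s * x * g, x * g * s, s * (g * x)})"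
proof (induction S arbitrary: F)
  case (Cons s S)
  have "y \<in> elems (inss [g * (x * s), x * s * g] (inss [g * (s * x), s * x * g] (inss [x * g * s, s * (g * x)] F)))
    \<or> (\<exists>s\<in>set S. y \<in> {g * (x * s), x * s * g, g * (s * x), s * x * g, x * g * s, s * (g * x)})"
    by (rule Cons.IH) (use Cons.prems in simp_all)
  then show ?case using Cons.prems(1-3) by auto
qed simp

fun covered :: "mat list list \<Rightarrow> mat set" where
  "covered [] = {}"
| "covered (c # cs) = set c \<union> adj ` set c \<union> covered cs"

lemma covered_filter: "y \<in> covered cs \<Longrightarrow> p y \<Longrightarrow> (\<And>z. adj z = y \<Longrightarrow> p z) \<Longrightarrow> y \<in> covered (map (filter p) cs)"
  by (induction cs) auto

text \<open>
  A fixed set whose cube avoids \<open>G\<close>.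
\<close>

locale avoiding =
  fixes G :: "mat list" and T :: "mat set"
  assumes symm: "symm T" and subset: "T \<subseteq> SLm - {1, neg1}" and G: "set G \<subseteq> SLm"
    and avoid: "set G \<inter> cub (insert 1 T) = {}"
begin

abbreviation "W \<equiv> insert 1 T"

lemma symm_W: "symm W" using symm by (rule symm_insert_one)
lemma W_subset: "W \<subseteq> SLm" using subset by auto
lemma finite_T: "finite T" using subset finite_SLm finite_subset by blast

text \<open>
  Solving each of the six equations for \<open>g\<close> exhibits \<open>g\<close> as an element
  of the cube.
\<close>

lemma forb_sound:
  assumes x: "x \<in> W" and S: "set S \<subseteq> W" and y: "y \<in> elems (forb G x S)" shows "y \<notin> W"
proof
  assume yW: "y \<in> W"
  have step: False
    if g: "g \<in> set G" and z: "z \<in> W" and s: "s \<in> W"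
      and y: "y \<in> {g * (z * s), z * s * g, g * (s * z), s * z * g, z * g * s, s * (g * z)}" for g z s
  proof -
    have zs: "z \<in> SLm" "s \<in> SLm" "adj z \<in> W" "adj s \<in> W"
      using z s W_subset symm_W by (auto simp: symm_def)
    consider "y = g * (z * s)" | "y = z * s * g" | "y = g * (s * z)" | "y = s * z * g" | "y = z * g * s" | "y = s * (g * z)"
      using y by blast
    then have "g \<in> {y * adj s * adj z, adj s * adj z * y, y * adj z * adj s, adj z * adj s * y, adj z * y * adj s, adj s * y * adj z}"
      by cases (use zs in \<open>simp_all add: mult.assoc\<close>)
    then have "g \<in> cub W"
      using cubI[of _ W _ _] yW zs by auto
    then show False using g avoid by auto
  qed
  have "y \<in> elems (forb G' x S) \<Longrightarrow> set G' \<subseteq> set G \<Longrightarrow> False" for G'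
  proof (induction G')
    case (Cons g G')
    have SLm: "g \<in> SLm" "x \<in> SLm" "adj x \<in> SLm" "set S \<subseteq> SLm"
      using Cons.prems(2) G x S W_subset by auto
    have adj: "adj x \<in> W" using x symm_W unfolding symm_def by blast
    consider "y \<in> elems (spots g (adj x) (g * adj x) (adj x * g) S (forb G' x S))"
      | s where "s \<in> set S" "y \<in> {g * (x * s), x * s * g, g * (s * x), s * x * g, x * g * s, s * (g * x)}"
      using elems_spots[OF SLm(1,2,4)] Cons.prems(1) by auto
    then show False
    proof cases
      case 1
      consider "y \<in> elems (forb G' x S)"
        | s where "s \<in> set S" "y \<in> {g * (adj x * s), adj x * s * g, g * (s * adj x), s * adj x * g, adj x * g * s, s * (g * adj x)}"
        using elems_spots[OF SLm(1,3,4) 1] by auto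
      then show False
      proof cases
        case 1 then show False using Cons by auto
      next
        case 2 then show False using step[of g "adj x" s] adj S Cons.prems(2) by auto
      qed
    next
      case 2 then show False using step[of g x s] x S Cons.prems(2) by auto
    qed
  qed simp
  then show False using y by blast
qed

definition exclusive :: "mat list \<Rightarrow> bool" where
  "exclusive c \<longleftrightarrow> (\<forall>y\<in>set c. \<forall>z\<in>set c. y \<in> T \<longrightarrow> z \<in> T \<longrightarrow> y = z)"

text \<open>
  The counterpart of \<open>reached\<close>. The summand \<open>1\<close> matches the rounding
  in \<open>pairs\<close>.
\<close>

definition cornered :: "mat list \<Rightarrow> nat \<Rightarrow> mat list list \<Rightarrow> bool" where
  "cornered S n cs \<longleftrightarrow> 1 \<in> set S \<and> set S \<subseteq> W \<and> T \<subseteq> set S \<union> covered cs \<and> 2 * n \<le> card (T - set S) + 1 \<and>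
    (\<forall>c\<in>set cs. set c \<subseteq> SLm \<and> exclusive c)"

lemma clear_in_T: "(\<And>z. z \<in> elems F \<Longrightarrow> z \<notin> W) \<Longrightarrow> y \<in> T \<Longrightarrow> y \<in> SLm \<Longrightarrow> clear F y"
  using symm_adj_iff[OF symm, of y] by (auto simp: clear_def mem_elems)

lemma card_cell:
  assumes "exclusive c" shows "card (U \<inter> T \<inter> (set c \<union> adj ` set c)) \<le> 2"
proof (cases "\<exists>y\<in>set c. y \<in> T")
  case True
  then obtain y where y: "y \<in> set c" "y \<in> T" by blast
  have "U \<inter> T \<inter> (set c \<union> adj ` set c) \<subseteq> {y, adj y}"
  proof
    fix t assume "t \<in> U \<inter> T \<inter> (set c \<union> adj ` set c)"
    then obtain z where "z \<in> set c" "z \<in> T" "t = z \<or> t = adj z"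
      using symm_adj_iff[OF symm] by blast
    then show "t \<in> {y, adj y}" using assms y by (auto simp: exclusive_def)
  qed
  then have "card (U \<inter> T \<inter> (set c \<union> adj ` set c)) \<le> card {y, adj y}" by (intro card_mono) auto
  also have "\<dots> \<le> 2" using card_length[of "[y, adj y]"] by simp
  finally show ?thesis .
next
  case False
  then have "U \<inter> T \<inter> (set c \<union> adj ` set c) = {}" using symm_adj_iff[OF symm] by auto
  then show ?thesis by simp
qed

text \<open>
  A cell meets \<open>T\<close> in at most one pair. The set \<open>U\<close> will be the
  complement of the part chosen so far.
\<close>

lemma short_sound: "short n cs \<Longrightarrow> \<forall>c\<in>set cs. exclusive c \<Longrightarrow> card (U \<inter> T \<inter> covered cs) + 2 \<le> 2 * n"
proof (induction n cs rule: short.induct)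
  case (4 n x xs cs)
  have "card (U \<inter> T \<inter> covered ((x # xs) # cs))
      \<le> card (U \<inter> T \<inter> (set (x # xs) \<union> adj ` set (x # xs))) + card (U \<inter> T \<inter> covered cs)"
    unfolding covered.simps Int_Un_distrib[of "U \<inter> T"] by (rule card_Un_le)
  also have "\<dots> \<le> 2 + card (U \<inter> T \<inter> covered cs)"
    by (intro add_right_mono card_cell) (use 4(3) in simp)
  finally show ?case using 4 by auto
qed auto

lemma few_missing_sound:
  assumes "few_missing S" "set S = W" shows "card (missing T) \<le> slack (pairs T)"
proof -
  have sq: "set xs \<subseteq> W \<Longrightarrow> set (fst P) \<subseteq> sq W \<Longrightarrow> set (fst (all_squares S xs P)) \<subseteq> sq W" for xs P
    using assms(2) symm_W by (induction xs arbitrary: P) (auto simp: set_squares)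
  let ?ps = "fst (all_squares S S ([], Empty))"
  have ps: "set ?ps \<subseteq> sq W" using sq[of S] assms(2) by auto
  have "set xs \<subseteq> W \<Longrightarrow> counts (cub W) 120 st \<Longrightarrow> counts (cub W) 120 (all_cubes ?ps xs st)" for xs st
  proof (induction xs arbitrary: st)
    case (Cons x xs)
    have "counts (cub W) 120 (cubes x ?ps st)"
      using Cons.prems ps symm_W W_subset by (intro counts_cubes) auto
    then show ?case using Cons.IH Cons.prems by simp
  qed simp
  from this[of S "(120, Empty)"] have "card (missing T) \<le> fst (all_cubes ?ps S (120, Empty))"
    using assms(2) subset by (intro card_missing_le) (auto simp: counts_def)
  also have "\<dots> \<le> slack (length S div 2)" using assms(1) by (simp add: few_missing_def)
  also have "\<dots> \<le> slack (pairs T)"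
  proof (rule antimonoD[OF antimono_slack])
    have "Suc (card T) = card (set S)" using assms(2) subset finite_T by (simp add: card_insert_if) auto
    also have "\<dots> \<le> length S" by (rule card_length)
    finally show "pairs T \<le> length S div 2" by (simp add: pairs_def div_le_mono)
  qed
  finally show ?thesis .
qed

lemma cornered_enter:
  assumes S: "1 \<in> set S" "set S \<subseteq> W" and x: "x \<in> T"
    and T: "T \<subseteq> {x, adj x} \<union> set S \<union> covered cs" "2 * n \<le> card (T - set S) + 1"
    and cs: "\<forall>c\<in>set cs. set c \<subseteq> SLm \<and> exclusive c" and F: "\<And>z. z \<in> elems F \<Longrightarrow> z \<notin> W"
  shows "cornered (x # adj x # S) (n - 1) (map (filter (clear F)) cs)"
proof -
  have "card (T - set S) \<le> card ((T - set (x # adj x # S)) \<union> {x, adj x})"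
    by (intro card_mono) (auto simp: finite_T)
  also have "\<dots> \<le> card (T - set (x # adj x # S)) + card {x, adj x}" by (rule card_Un_le)
  also have "\<dots> \<le> card (T - set (x # adj x # S)) + 2" using card_length[of "[x, adj x]"] by simp
  finally have card: "2 * (n - 1) \<le> card (T - set (x # adj x # S)) + 1" using T(2) by simp
  have "t \<in> set (x # adj x # S) \<union> covered (map (filter (clear F)) cs)" if "t \<in> T" for t
  proof -
    have "clear F t" "clear F (adj t)"
      using that subset symm F by (auto intro!: clear_in_T simp: symm_def)
    then have "t \<in> covered cs \<Longrightarrow> t \<in> covered (map (filter (clear F)) cs)"
      by (intro covered_filter) (auto simp: clear_def)
    then show ?thesis using T(1) that by auto
  qed
  then have T': "T \<subseteq> set (x # adj x # S) \<union> covered (map (filter (clear F)) cs)" by blast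
  have "set c \<subseteq> SLm \<and> exclusive c" if c: "c \<in> set (map (filter (clear F)) cs)" for c
  proof -
    obtain d where "d \<in> set cs" "c = filter (clear F) d" using c unfolding set_map by blast
    then have "d \<in> set cs" "set c \<subseteq> set d" by simp_all
    then show ?thesis using cs unfolding exclusive_def by blast
  qed
  moreover have "adj x \<in> T" using x symm by (simp add: symm_def)
  ultimately show ?thesis
    unfolding cornered_def using S x card T' by simp
qed

lemma not_hits: "(\<And>z. z \<in> elems F \<Longrightarrow> z \<notin> W) \<Longrightarrow> set S \<subseteq> W \<Longrightarrow> \<not> hits F S"
  using W_subset unfolding all_clear by (meson mem_elems subsetD)

text \<open>
  As in \<open>explore_sound\<close>, the branch that agrees with \<open>T\<close> is followed.
  Cutting off by \<open>short\<close> cannot happen on it.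
\<close>

lemma search_sound: "search G' S n cs \<Longrightarrow> G' = G \<Longrightarrow> cornered S n cs \<Longrightarrow> card (missing T) \<le> slack (pairs T)"
proof (induction G' S n cs rule: search.induct)
  case (1 G' S n)
  then have c: "1 \<in> set S" "set S \<subseteq> W" "T \<subseteq> set S" "2 * n \<le> card (T - set S) + 1"
    by (simp_all add: cornered_def)
  have "T - set S = {}" using c(3) by blast
  then have "card (T - set S) = 0" by (simp only: card.empty)
  then have "n = 0" using c(4) by linarith
  moreover have "set S = W" using c(1-3) by blast
  ultimately show ?case using 1(1) few_missing_sound by simp
next
  case (2 G' S n cs)
  then show ?case by (simp add: cornered_def)
next
  case (3 G' S n x xs cs)
  have c: "cornered S n ((x # xs) # cs)" and G': "G' = G" using 3 by auto
  have "\<not> short n ((x # xs) # cs)"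
  proof
    assume "short n ((x # xs) # cs)"
    then have "card ((- set S) \<inter> T \<inter> covered ((x # xs) # cs)) + 2 \<le> 2 * n"
      using c by (intro short_sound) (auto simp: cornered_def)
    moreover have "(- set S) \<inter> T \<inter> covered ((x # xs) # cs) = T - set S"
      using c unfolding cornered_def by blast
    ultimately show False using c unfolding cornered_def by simp
  qed
  then have both: "hits (forb G x (x # adj x # S)) (x # adj x # S) \<or>
      search G (x # adj x # S) (n - 1) (map (filter (clear (forb G x (x # adj x # S)))) cs)"
    "search G S n (xs # cs)"
    using 3(3) G' by simp_all
  show ?case
  proof (cases "x \<in> T")
    case True
    have adj: "adj x \<in> T" using True symm by (simp add: symm_def)
    have F: "z \<in> elems (forb G x (x # adj x # S)) \<Longrightarrow> z \<notin> W" for z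
      using True adj c by (intro forb_sound) (auto simp: cornered_def)
    have ex: "exclusive (x # xs)" using c by (simp add: cornered_def)
    have "T \<subseteq> {x, adj x} \<union> set S \<union> covered cs"
    proof
      fix t assume t: "t \<in> T"
      show "t \<in> {x, adj x} \<union> set S \<union> covered cs"
      proof (cases "t \<in> set (x # xs) \<union> adj ` set (x # xs)")
        case in_cell: True
        then obtain z where "z \<in> set (x # xs)" "z \<in> T" "t = z \<or> t = adj z"
          using t symm_adj_iff[OF symm] by blast
        then show ?thesis using ex True by (auto simp: exclusive_def)
      next
        case False
        then show ?thesis using t c unfolding cornered_def by auto
      qed
    qed
    then have "cornered (x # adj x # S) (n - 1) (map (filter (clear (forb G x (x # adj x # S)))) cs)"
      using c True F by (intro cornered_enter) (auto simp: cornered_def)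
    moreover have "\<not> hits (forb G x (x # adj x # S)) (x # adj x # S)"
      using c True adj F by (intro not_hits) (auto simp: cornered_def)
    ultimately show ?thesis using 3(1) both(1) G' by simp
  next
    case False
    then have "adj x \<notin> T" using symm_adj_iff[OF symm] by blast
    then have "cornered S n (xs # cs)" using c False by (auto simp: cornered_def exclusive_def)
    then show ?thesis using 3(2) both(2) G' by simp
  qed
qed

lemma clique_sound: "set c \<subseteq> SLm \<Longrightarrow> exclusive (clique G c) \<and> set (clique G c) \<subseteq> set c"
proof (induction "length c" arbitrary: c rule: less_induct)
  case less
  show ?case
  proof (cases c)
    case (Cons y ys)
    let ?F = "forb G y [y, adj y, 1]"
    have IH: "exclusive (clique G (filter (\<lambda>z. \<not> clear ?F z) ys))"
      "set (clique G (filter (\<lambda>z. \<not> clear ?F z) ys)) \<subseteq> {z \<in> set ys. \<not> clear ?F z}"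
      using less(1)[of "filter (\<lambda>z. \<not> clear ?F z) ys"] less(2) Cons by (auto simp: less_Suc_eq_le)
    have "z \<notin> T" if "y \<in> T" "z \<in> set (clique G (filter (\<lambda>z. \<not> clear ?F z) ys))" for z
    proof
      assume z: "z \<in> T"
      have "adj y \<in> T" using that(1) symm by (simp add: symm_def)
      then have "clear ?F z"
        using that z less(2) Cons subset by (intro clear_in_T forb_sound) auto
      then show False using that(2) IH(2) by auto
    qed
    then have "exclusive (y # clique G (filter (\<lambda>z. \<not> clear ?F z) ys))"
      using IH(1) by (auto simp: exclusive_def)
    then show ?thesis using IH(2) Cons by auto
  qed (simp add: exclusive_def)
qed

lemma greedy_sound:
  "set ys \<subseteq> SLm \<Longrightarrow> (\<forall>c\<in>set (greedy G ys). set c \<subseteq> SLm \<and> exclusive c) \<and> set ys \<subseteq> \<Union> (set ` set (greedy G ys))"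
proof (induction "length ys" arbitrary: ys rule: less_induct)
  case less
  show ?case
  proof (cases ys)
    case (Cons y zs)
    let ?c = "clique G (y # zs)" and ?r = "filter (\<lambda>z. \<not> mem z (inss (clique G (y # zs)) Empty)) zs"
    have c: "exclusive ?c" "set ?c \<subseteq> set (y # zs)" using clique_sound[of "y # zs"] less(2) Cons by auto
    have r: "set ?r = set zs - set ?c"
    proof -
      have "elems (inss ?c Empty) = set ?c"
        using c(2) less(2) Cons by (subst elems_inss) (auto simp del: clique.simps)
      then show ?thesis
        using less(2) Cons by (auto simp: mem_elems simp del: clique.simps inss.simps)
    qed
    have "(\<forall>c\<in>set (greedy G ?r). set c \<subseteq> SLm \<and> exclusive c) \<and> set ?r \<subseteq> \<Union> (set ` set (greedy G ?r))"
      using less(1)[of ?r] less(2) Cons by (auto simp: less_Suc_eq_le simp del: clique.simps)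
    moreover have "y \<in> set ?c" by simp
    ultimately show ?thesis
      using c r less(2) unfolding Cons greedy.simps by (auto simp del: clique.simps)
  qed simp
qed

end

lemma covered_Union: "covered cs = \<Union> (set ` set cs) \<union> adj ` \<Union> (set ` set cs)"
  by (induction cs) auto

text \<open>
  The sets that avoid \<open>G\<close> form a class that is closed under the stabiliser of
  \<open>G\<close>, so elements can be struck out by orbits before the cells are counted.
\<close>

theorem unavoidable_sound:
  assumes G: "set G \<subseteq> SLm" and rs: "represents rs" and un: "unavoidable rs G n"
    and T: "slow T" "2 * n \<le> card T + 1"
  shows "set G \<inter> cub (insert 1 T) \<noteq> {}"
proof
  assume av: "set G \<inter> cub (insert 1 T) = {}"
  let ?V = "{T. slow T \<and> 2 * n \<le> card T + 1 \<and> set G \<inter> cub (insert 1 T) = {}}"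
  let ?cs = "cells rs G"
  have avoiding: "avoiding G T" if "T \<in> ?V" for T
    using that G by unfold_locales (auto simp: slow_def)
  have rs_SLm: "set rs \<subseteq> SLm" using rs by (simp add: represents_def)
  interpret V: conj_class ?V "stab G"
  proof
    fix P T assume P: "P \<in> set (stab G)" and T: "T \<in> ?V"
    note unit = stabD[OF P]
    have "g \<notin> cub (insert 1 (uncj P ` T))" if "g \<in> set G" for g
    proof
      assume "g \<in> cub (insert 1 (uncj P ` T))"
      then obtain c where c: "c \<in> cub (insert 1 T)" "g = uncj P c"
        unfolding insert_one_uncj[OF unit] cub_image_uncj[OF unit] by blast
      then have "cj P g \<in> cub (insert 1 T)" "adj (cj P g) \<in> cub (insert 1 T)"
        using T adj_in_cub[OF symm_insert_one] by (auto simp: cj_uncj unit slow_def)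
      then show False using stab_cases[OF P that] T by auto
    qed
    then show "uncj P ` T \<in> ?V" using T slow_image_uncj[OF unit] by (auto simp: card_image_uncj unit)
  qed (auto simp: stabD slow_def)
  have cells: "\<forall>c\<in>set ?cs. set c \<subseteq> SLm \<and> avoiding.exclusive T c" "T \<subseteq> covered ?cs" if T: "T \<in> ?V" for T
  proof -
    interpret avoiding G T by (rule avoiding[OF T])
    let ?ok = "filter (\<lambda>x. \<not> hits (forb G x [x, adj x, 1]) [x, adj x, 1]) rs"
    have gr: "(\<forall>c\<in>set ?cs. set c \<subseteq> SLm \<and> exclusive c) \<and> set ?ok \<subseteq> \<Union> (set ` set ?cs)"
      unfolding cells_def using rs_SLm by (intro greedy_sound) auto
    then show "\<forall>c\<in>set ?cs. set c \<subseteq> SLm \<and> exclusive c" by blast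
    show "T \<subseteq> covered ?cs"
    proof
      fix t assume t: "t \<in> T"
      obtain z where z: "z \<in> set rs" "z \<in> T" "t = z \<or> t = adj z"
        using representsD[OF rs subset symm t] .
      have "adj z \<in> T" using z(2) symm by (simp add: symm_def)
      then have "\<not> hits (forb G z [z, adj z, 1]) [z, adj z, 1]"
        using z(2) by (intro not_hits forb_sound) auto
      then have "z \<in> \<Union> (set ` set ?cs)" using gr z(1) by auto
      then show "t \<in> covered ?cs" using z(3) unfolding covered_Union by blast
    qed
  qed
  have remaining: "t \<in> X \<union> covered (remaining D ?cs)"
    if T: "T \<in> ?V" and t: "t \<in> T" and D: "\<And>y. y \<in> elems D \<Longrightarrow> y \<in> T \<Longrightarrow> y \<in> X \<and> adj y \<in> X" for T t D X
  proof -
    interpret avoiding G T by (rule avoiding[OF T])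
    obtain z where z: "z \<in> \<Union> (set ` set ?cs)" "t = z \<or> t = adj z"
      using cells(2)[OF T] t unfolding covered_Union by blast
    then have zT: "z \<in> T" using t symm_adj_iff[OF symm] by blast
    show ?thesis
    proof (cases "z \<in> elems D")
      case True then show ?thesis using D zT z(2) by auto
    next
      case False
      then have "\<not> mem z D" using zT subset by (auto simp: mem_elems)
      then have "z \<in> \<Union> (set ` set (remaining D ?cs))" using z(1) by (auto simp: remaining_def)
      then show ?thesis using z(2) unfolding covered_Union by blast
    qed
  qed
  have sub: "\<forall>c\<in>set (remaining D ?cs). set c \<subseteq> SLm \<and> avoiding.exclusive T c" if T: "T \<in> ?V" for T D
    using cells(1)[OF T] avoiding.exclusive_def[OF avoiding[OF T]] by (fastforce simp: remaining_def)
  have slowD: "\<not> card (missing T) \<le> slack (pairs T)" if "T \<in> ?V" for T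
    using that by (auto simp: slow_def)
  have test: "dead ?V x"
    if x: "x \<in> set rs" and t: "avoid_test G n ?cs x D" and D: "\<forall>y\<in>elems D. dead ?V y" for x D
  proof (rule deadI, rule notI)
    fix T assume TV: "T \<in> ?V" and xT: "x \<in> T"
    interpret avoiding G T by (rule avoiding[OF TV])
    have adj: "adj x \<in> T" using xT symm by (simp add: symm_def)
    have F: "z \<in> elems (forb G x [x, adj x, 1]) \<Longrightarrow> z \<notin> W" for z
      using xT adj by (intro forb_sound) auto
    have ins: "elems (ins x D) = insert x (elems D)" using x rs_SLm by (intro elems_ins) auto
    have "T \<subseteq> {x, adj x} \<union> set [1] \<union> covered (remaining (ins x D) ?cs)"
    proof
      fix t assume "t \<in> T"
      then have "t \<in> {x, adj x} \<union> covered (remaining (ins x D) ?cs)"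
        by (rule remaining[OF TV]) (use ins D TV in \<open>auto simp: dead_def\<close>)
      then show "t \<in> {x, adj x} \<union> set [1] \<union> covered (remaining (ins x D) ?cs)" by auto
    qed
    moreover have "T - set [1] = T" using subset by auto
    ultimately have "cornered (x # adj x # [1]) (n - 1)
        (map (filter (clear (forb G x [x, adj x, 1]))) (remaining (ins x D) ?cs))"
      using xT F TV sub[OF TV] by (intro cornered_enter) auto
    moreover have "\<not> hits (forb G x [x, adj x, 1]) [x, adj x, 1]"
      using xT adj F by (intro not_hits) auto
    ultimately have "card (missing T) \<le> slack (pairs T)"
      using t search_sound[OF _ refl] by (auto simp: avoid_test_def enter_def)
    then show False using slowD[OF TV] by blast
  qed
  have dead: "\<forall>y\<in>elems (sweep (avoid_test G n ?cs) (stab G) rs Empty). dead ?V y"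
    using rs_SLm by (intro V.dead_sweep test) auto
  have TV: "T \<in> ?V" using T av by simp
  interpret avoiding G T by (rule avoiding[OF TV])
  let ?R = "remaining (sweep (avoid_test G n ?cs) (stab G) rs Empty) ?cs"
  have "T \<subseteq> {} \<union> covered ?R"
    using remaining[OF TV, of _ "sweep (avoid_test G n ?cs) (stab G) rs Empty" "{}"] dead TV by (auto simp: dead_def)
  moreover have "T - set [1] = T" using subset by auto
  ultimately have "cornered [1] n ?R"
    using TV sub[OF TV] by (auto simp: cornered_def)
  then have "card (missing T) \<le> slack (pairs T)"
    using un search_sound[OF _ refl] by (simp add: unavoidable_def avoid_from_def)
  then show False using slowD[OF TV] by blast
qed

section \<open>The searches\<close>

text \<open>
  In the following five checks each element may use those before it. Elements of order
  \<open>5\<close> come first, as they lie in a single maximal subgroup.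
\<close>

lemma kills_order_5: "kills (M F0 F1 F4 F2) []"
  by code_simp

lemma kills_order_10: "kills (M F0 F1 F4 F3) [M F0 F1 F4 F2]"
  by code_simp

lemma kills_order_3: "kills (M F0 F1 F4 F4) [M F0 F1 F4 F2, M F0 F1 F4 F3]"
  by code_simp

lemma kills_order_6: "kills (M F0 F1 F4 F1) [M F0 F1 F4 F2, M F0 F1 F4 F3, M F0 F1 F4 F4]"
  by code_simp

lemma kills_order_4:
  "kills (M F0 F1 F4 F0) [M F0 F1 F4 F2, M F0 F1 F4 F3, M F0 F1 F4 F4, M F0 F1 F4 F1]"
  by code_simp

text \<open>
  Three elements of order \<open>4\<close> that cannot be missing together, and of whose
  conjugates every eight pairs of order \<open>4\<close> contain one.
\<close>

definition triple :: "mat list" where "triple = [M F1 F1 F3 F4, M F1 F2 F4 F4, M F1 F3 F1 F4]"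

lemma unavoidable_order_3: "unavoidable reps [M F1 F3 F4 F3] 12"
  by code_simp

lemma unavoidable_order_5: "unavoidable reps [M F3 F1 F1 F4] 12"
  by code_simp

lemma unavoidable_order_6: "unavoidable reps [M F2 F1 F2 F4] 12"
  by code_simp

lemma unavoidable_order_10: "unavoidable reps [M F4 F0 F1 F4] 12"
  by code_simp

lemma unavoidable_triple: "unavoidable reps triple 12"
  by code_simp

lemma unavoidable_neg1: "unavoidable reps [neg1] 14"
  by code_simp

text \<open>
  Some sets of fourteen pairs do avoid an element of order \<open>4\<close>. Their cubes have at
  least \<open>114\<close> elements, so they are not slow.
\<close>

lemma unavoidable_order_4: "unavoidable reps4 [M F1 F3 F1 F4] 14"
  by code_simp

section \<open>No set is slow\<close>

lemma conj_class_pgl: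
  assumes "\<And>T. T \<in> \<V> \<Longrightarrow> symm T" "\<And>P T. dt P \<noteq> 0 \<Longrightarrow> T \<in> \<V> \<Longrightarrow> uncj P ` T \<in> \<V>"
  shows "conj_class \<V> pgl"
  using assms by unfold_locales (auto simp: dt_pgl)

lemma elems_all: "all_in H xs \<Longrightarrow> set xs \<subseteq> SLm \<Longrightarrow> set xs \<subseteq> elems H"
  by (auto simp: all_in_iff mem_elems subset_iff)

text \<open>
  The five representatives meet all conjugacy classes of inverse pairs.
\<close>

lemma noncentral_orbits:
  "SLm \<subseteq> {1, neg1} \<union> elems (orbits pgl
    [M F0 F1 F4 F2, M F0 F1 F4 F3, M F0 F1 F4 F4, M F0 F1 F4 F1, M F0 F1 F4 F0] Empty)"
proof -
  have "all_in (ins 1 (ins neg1 (orbits pgl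
      [M F0 F1 F4 F2, M F0 F1 F4 F3, M F0 F1 F4 F4, M F0 F1 F4 F1, M F0 F1 F4 F0] Empty))) sl"
    by code_simp
  from elems_all[OF this] show ?thesis by (simp add: set_sl)
qed

lemma not_spans_empty: "\<not> spans {}"
proof
  assume "spans {}"
  then have "SLm \<subseteq> {1, neg1}"
    unfolding spans_def by (elim allE[of _ "{1, neg1}"]) (auto simp: neg1_neg1)
  then have "card SLm \<le> card {1, neg1}" by (intro card_mono) auto
  also have "\<dots> \<le> 2" using card_length[of "[1, neg1]"] by simp
  finally show False by (simp add: card_SLm)
qed

lemma small_not_slow: "card T \<le> 22 \<Longrightarrow> \<not> slow T"
proof
  assume T: "card T \<le> 22" "slow T"
  interpret conj_class small_slow pgl
    by (rule conj_class_pgl) (auto simp: small_slow_uncj, auto simp: small_slow_def slow_def)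
  have SLm: "M F0 F1 F4 F2 \<in> SLm" "M F0 F1 F4 F3 \<in> SLm" "M F0 F1 F4 F4 \<in> SLm"
    "M F0 F1 F4 F1 \<in> SLm" "M F0 F1 F4 F0 \<in> SLm"
    by (simp_all add: SLm_def one_f5_def minus_f5_def)
  note d5 = kills_dead[OF kills_order_5, simplified]
  note d10 = kills_dead[OF kills_order_10, simplified, OF SLm(1) d5]
  note d3 = kills_dead[OF kills_order_3, simplified, OF conjI[OF SLm(1,2)] conjI[OF d5 d10]]
  note d6 = kills_dead[OF kills_order_6, simplified, OF conjI[OF SLm(1) conjI[OF SLm(2,3)]] conjI[OF d5 conjI[OF d10 d3]]]
  note d4 = kills_dead[OF kills_order_4, simplified, OF conjI[OF SLm(1) conjI[OF SLm(2) conjI[OF SLm(3,4)]]]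
      conjI[OF d5 conjI[OF d10 conjI[OF d3 d6]]]]
  have "\<forall>y\<in>elems (orbits pgl
      [M F0 F1 F4 F2, M F0 F1 F4 F3, M F0 F1 F4 F4, M F0 F1 F4 F1, M F0 F1 F4 F0] Empty). dead small_slow y"
    using SLm d5 d10 d3 d6 d4 by (intro dead_orbits) auto
  moreover have "T \<in> small_slow" using T by (simp add: small_slow_def)
  ultimately have "T = {}"
    using noncentral_orbits T(2) unfolding dead_def slow_def by blast
  then show False using T(2) not_spans_empty by (simp add: slow_def)
qed

text \<open>
  Regarded as the class of sets in \<open>conj_class\<close>, the sets of missing elements turn
  conjugation of slow sets into a statement about what they miss.
\<close>

definition big_missing :: "nat \<Rightarrow> mat set set" where
  "big_missing n = {missing T | T. slow T \<and> 2 * n \<le> card T + 1}"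

lemma symm_missing: "symm T \<Longrightarrow> symm (missing T)"
  using adj_in_cub[OF symm_insert_one] by (fastforce simp: symm_def missing_def)

lemma conj_class_big_missing: "conj_class (big_missing n) pgl"
proof (rule conj_class_pgl)
  fix X assume "X \<in> big_missing n"
  then obtain T where T: "X = missing T" "slow T" "2 * n \<le> card T + 1" by (auto simp: big_missing_def)
  then show "symm X" by (simp add: slow_def symm_missing)
  fix P assume P: "dt P \<noteq> 0"
  have "uncj P ` X = missing (uncj P ` T)" "slow (uncj P ` T)" "2 * n \<le> card (uncj P ` T) + 1"
    using T P by (simp_all add: missing_image_uncj slow_image_uncj card_image_uncj)
  then show "uncj P ` X \<in> big_missing n" unfolding big_missing_def by blast
qed

lemma unavoidable_dead:
  assumes "represents rs" "unavoidable rs [g] n" "g \<in> SLm" shows "dead (big_missing n) g"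
  using unavoidable_sound[OF _ assms(1,2)] assms(3) by (auto simp: dead_def big_missing_def missing_def)

lemma unavoidable_orbit:
  assumes "unavoidable rs G n" "represents rs" "set G \<subseteq> SLm" "slow T" "2 * n \<le> card T + 1" "dt P \<noteq> 0"
  shows "\<not> cj P ` set G \<subseteq> missing T"
proof
  assume sub: "cj P ` set G \<subseteq> missing T"
  obtain g where g: "g \<in> set G" "g \<in> cub (insert 1 (uncj P ` T))"
    using unavoidable_sound[OF assms(3,2,1), of "uncj P ` T"] assms(4-6)
    by (auto simp: slow_image_uncj card_image_uncj)
  then have "cj P g \<in> cub (insert 1 T)"
    using assms(6) by (auto simp: insert_one_uncj cub_image_uncj cj_uncj simp del: image_insert)
  then show False using sub g(1) by (auto simp: missing_def)
qed

text \<open>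
  Elements of orders \<open>3\<close>, \<open>5\<close>, \<open>6\<close> and \<open>10\<close>
  cannot be missing. The elements of order \<open>4\<close> are those of trace \<open>0\<close>.
\<close>

lemma missing_trace_0_or_central:
  assumes T: "slow T" "24 \<le> card T + 1" and x: "x \<in> missing T"
  shows "tr x = F0 \<or> x = neg1"
proof -
  interpret conj_class "big_missing 12" pgl by (rule conj_class_big_missing)
  let ?gs = "[M F1 F3 F4 F3, M F3 F1 F1 F4, M F2 F1 F2 F4, M F4 F0 F1 F4]"
  have SLm: "set ?gs \<subseteq> SLm" by (simp add: SLm_def one_f5_def minus_f5_def)
  have "\<forall>g\<in>set ?gs. dead (big_missing 12) g"
    using SLm unavoidable_dead[OF represents_reps(1)] unavoidable_order_3 unavoidable_order_5
      unavoidable_order_6 unavoidable_order_10 by simp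
  then have dead: "\<forall>y\<in>elems (orbits pgl ?gs Empty). dead (big_missing 12) y"
    using SLm by (intro dead_orbits) auto
  have "all_in (ins 1 (ins neg1 (orbits pgl ?gs Empty))) (filter (\<lambda>x. tr x \<noteq> F0) sl)"
    by code_simp
  from elems_all[OF this] have cover: "{x \<in> SLm. tr x \<noteq> F0} \<subseteq> {1, neg1} \<union> elems (orbits pgl ?gs Empty)"
    by (auto simp: set_sl)
  have "x \<in> SLm" "x \<noteq> 1" using x cubI[of 1 _ 1 1] by (auto simp: missing_def)
  moreover have "\<not> dead (big_missing 12) x"
    using T x by (auto simp: dead_def big_missing_def)
  ultimately show ?thesis using cover dead by blast
qed

lemma trace_0_orbit: "x \<in> SLm \<Longrightarrow> tr x = F0 \<Longrightarrow> x \<in> elems (orbits pgl [M F1 F3 F1 F4] Empty)"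
proof -
  have "all_in (orbits pgl [M F1 F3 F1 F4] Empty) (filter (\<lambda>x. tr x = F0) sl)" by code_simp
  from elems_all[OF this] show "x \<in> SLm \<Longrightarrow> tr x = F0 \<Longrightarrow> ?thesis" by (auto simp: set_sl)
qed

lemma large_not_slow: "28 \<le> card T + 1 \<Longrightarrow> \<not> slow T"
proof
  assume T: "28 \<le> card T + 1" "slow T"
  interpret conj_class "big_missing 14" pgl by (rule conj_class_big_missing)
  have "M F1 F3 F1 F4 \<in> SLm" by (simp add: SLm_def one_f5_def minus_f5_def)
  then have "\<forall>y\<in>elems (orbits pgl [M F1 F3 F1 F4] Empty). dead (big_missing 14) y"
    using unavoidable_dead[OF represents_reps(2) unavoidable_order_4] by (intro dead_orbits) auto
  moreover have "dead (big_missing 14) neg1"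
    by (rule unavoidable_dead[OF represents_reps(1) unavoidable_neg1]) simp
  moreover have "missing T \<in> big_missing 14" using T by (auto simp: big_missing_def)
  ultimately have dead: "x \<in> elems (orbits pgl [M F1 F3 F1 F4] Empty) \<or> x = neg1 \<Longrightarrow> x \<notin> missing T" for x
    unfolding dead_def by blast
  have "x \<notin> missing T" for x
  proof
    assume x: "x \<in> missing T"
    then have "tr x = F0 \<or> x = neg1" using missing_trace_0_or_central[OF T(2) _ x] T(1) by simp
    moreover have "x \<in> SLm" using x by (simp add: missing_def)
    ultimately show False using dead[of x] trace_0_orbit[of x] x by blast
  qed
  then have "missing T = {}" by blast
  then show False using T(2) by (simp add: slow_def)
qed

text \<open>
  Any \<open>n\<close> elements of the list include all elements of one of the sets
  \<open>ts\<close>. If \<open>x\<close> is left out, the sets that contain \<open>x\<close> are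
  lost; if \<open>x\<close> is taken, it can be removed from all of them.
\<close>

fun crowded :: "mat list list \<Rightarrow> nat \<Rightarrow> mat list \<Rightarrow> bool" where
  "crowded ts n [] \<longleftrightarrow> n \<noteq> 0"
| "crowded ts n (x # xs) \<longleftrightarrow>
    (if length (x # xs) < n then True
     else if crowded (filter (\<lambda>t. x \<notin> set t) ts) n xs
     then (if [] \<in> set (map (filter (\<lambda>y. y \<noteq> x)) ts) then True
       else crowded (map (filter (\<lambda>y. y \<noteq> x)) ts) (n - 1) xs)
     else False)"

lemma crowded_sound: "crowded ts n xs \<Longrightarrow> n \<le> card (X \<inter> set xs) \<Longrightarrow> \<exists>t\<in>set ts. set t \<subseteq> X"
proof (induction ts n xs rule: crowded.induct)
  case (2 ts n x xs)
  have "card (X \<inter> set (x # xs)) \<le> card (set (x # xs))" by (intro card_mono) auto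
  also have "\<dots> \<le> length (x # xs)" by (rule card_length)
  finally have len: "\<not> length (x # xs) < n" using 2(4) by simp
  have without: "crowded (filter (\<lambda>t. x \<notin> set t) ts) n xs"
    using 2(3) len by (auto split: if_splits)
  show ?case
  proof (cases "x \<in> X")
    case True
    have "X \<inter> set (x # xs) \<subseteq> insert x (X \<inter> set xs)" by auto
    then have "card (X \<inter> set (x # xs)) \<le> card (insert x (X \<inter> set xs))" by (intro card_mono) auto
    also have "\<dots> \<le> Suc (card (X \<inter> set xs))" by (simp add: card_insert_if)
    finally have le: "n - 1 \<le> card (X \<inter> set xs)" using 2(4) by simp
    have "\<exists>t\<in>set (map (filter (\<lambda>y. y \<noteq> x)) ts). set t \<subseteq> X"
    proof (cases "[] \<in> set (map (filter (\<lambda>y. y \<noteq> x)) ts)")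
      case False
      then have "crowded (map (filter (\<lambda>y. y \<noteq> x)) ts) (n - 1) xs"
        using 2(3) len by (auto split: if_splits)
      then show ?thesis using 2(2)[OF len without False _ le] by blast
    next
      case True
      show ?thesis by (rule bexI[OF _ True]) simp
    qed
    then show ?thesis using True by auto
  next
    case False
    then have "X \<inter> set (x # xs) = X \<inter> set xs" by auto
    then show ?thesis using 2(1)[OF len without] 2(4) by auto
  qed
qed auto

text \<open>
  Representatives of the fifteen pairs of order \<open>4\<close>, which become the involutions
  of the quotient by the centre.
\<close>

definition involutions :: "mat list" where "involutions = filter (\<lambda>x. tr x = F0) reps"

definition involution_rep :: "mat \<Rightarrow> mat" where
  "involution_rep x = (if x \<in> set involutions then x else adj x)"

text \<open>
  Conjugation by matrices of square determinant already yields all conjugates of the triple.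
\<close>

definition triples :: "mat list list" where
  "triples = map (\<lambda>P. map (\<lambda>g. involution_rep (cj P g)) triple)
    (filter (\<lambda>P. dt P = F1 \<or> dt P = F4) pgl)"

lemma crowded_triples: "crowded triples 8 involutions"
  by code_simp

lemma tr_adj [simp]: "tr (adj x) = tr x"
  by (cases x) (simp add: add.commute)

lemma adj_pgl_missing: "symm X \<Longrightarrow> involution_rep x \<in> X \<Longrightarrow> x \<in> X"
  using symm_adj_iff[of X x] by (auto simp: involution_rep_def split: if_splits)

text \<open>
  At least \<open>17\<close> elements are missing, all of order \<open>4\<close> except possibly
  \<open>-1\<close>. They include eight pairs and hence a conjugate of the triple.
\<close>

lemma medium_not_slow: "24 \<le> card T + 1 \<Longrightarrow> card T + 1 < 28 \<Longrightarrow> \<not> slow T"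
proof
  assume T: "24 \<le> card T + 1" "card T + 1 < 28" "slow T"
  let ?X = "missing T"
  have X: "?X \<subseteq> SLm" by (auto simp: missing_def)
  have sX: "symm ?X" using T(3) by (simp add: slow_def symm_missing)
  have Y: "set triple \<subseteq> SLm" by (simp add: triple_def SLm_def one_f5_def minus_f5_def)
  have sub: "?X \<subseteq> {neg1} \<union> ((?X \<inter> set involutions) \<union> adj ` (?X \<inter> set involutions))"
  proof
    fix x assume x: "x \<in> ?X"
    have x1: "x \<noteq> 1" using x cubI[of 1 "insert 1 T" 1 1] by (auto simp: missing_def)
    show "x \<in> {neg1} \<union> ((?X \<inter> set involutions) \<union> adj ` (?X \<inter> set involutions))"
    proof (cases "x = neg1")
      case False
      then have tr: "tr x = F0" using missing_trace_0_or_central[OF T(3,1) x] by simp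
      have "x \<in> set reps \<union> adj ` set reps"
        using represents_reps(1) x1 False x X unfolding represents_def by blast
      then obtain y where y: "y \<in> set reps" "x = y \<or> x = adj y" by blast
      then have "tr y = F0" using tr by auto
      moreover have "y \<in> ?X" using y(2) x symm_adj_iff[OF sX] by blast
      ultimately show ?thesis using y by (auto simp: involutions_def)
    qed simp
  qed
  have "card ?X \<le> card ({neg1} \<union> ((?X \<inter> set involutions) \<union> adj ` (?X \<inter> set involutions)))"
    using sub by (intro card_mono) auto
  also have "\<dots> \<le> 1 + (card (?X \<inter> set involutions) + card (?X \<inter> set involutions))"
    by (intro order_trans[OF card_Un_le] add_mono card_image_le order_trans[OF card_Un_le]) auto
  finally have card: "card ?X \<le> 1 + 2 * card (?X \<inter> set involutions)" by simp
  have "pairs T \<le> 13" using T(2) unfolding pairs_def by presburger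
  then have "slack 13 \<le> slack (pairs T)" by (rule antimonoD[OF antimono_slack])
  moreover have "slack 13 = 16" by code_simp
  ultimately have "16 < card ?X" using T(3) by (simp add: slow_def)
  \<comment> \<open>Of \<open>17\<close> missing elements at most one is central, and each pair has two elements.\<close>
  then have eight: "8 \<le> card (?X \<inter> set involutions)" using card by linarith
  from crowded_sound[OF crowded_triples eight]
  obtain t where "t \<in> set triples" "set t \<subseteq> ?X" by auto
  moreover from this obtain P where P: "P \<in> set pgl" "t = map (\<lambda>g. involution_rep (cj P g)) triple"
    by (auto simp: triples_def)
  ultimately have "\<forall>g\<in>set triple. involution_rep (cj P g) \<in> ?X" by auto
  then have "cj P ` set triple \<subseteq> ?X" using adj_pgl_missing[OF sX] by auto
  then show False
    using unavoidable_orbit[OF unavoidable_triple represents_reps(1) Y T(3) _ dt_pgl[OF P(1)]] T(1) by simp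
qed

theorem not_slow: "\<not> slow T"
  using small_not_slow[of T] medium_not_slow[of T] large_not_slow[of T] by linarith

section \<open>Transfer to the special linear group\<close>

fun residue :: "f5 \<Rightarrow> 5" where
  "residue F0 = 0" | "residue F1 = 1" | "residue F2 = 2" | "residue F3 = 3" | "residue F4 = 4"

lemma residue_hom:
  "residue (a + b) = residue a + residue b" "residue (a * b) = residue a * residue b"
  "residue (- a) = - residue a" "residue (a - b) = residue a - residue b"
proof -
  show add: "residue (a + b) = residue a + residue b" for a b by (cases a; cases b; simp)
  show uminus: "residue (- a) = - residue a" for a by (cases a; simp)
  show "residue (a * b) = residue a * residue b" by (cases a; cases b; simp)
  have "residue (a - b) = residue a + - residue b"
    by (simp only: minus_f5_def add uminus)
  then show "residue (a - b) = residue a - residue b" by simp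
qed

lemma residue_01 [simp]: "residue 0 = 0" "residue 1 = 1"
  by (simp_all add: zero_f5_def one_f5_def)

lemma residue_inj: "residue a = residue b \<longleftrightarrow> a = b"
  by (cases a; cases b; simp)

text \<open>
  An injection between sets of five elements is onto.
\<close>

lemma residue_surj: "\<exists>a. residue a = r"
proof -
  have U: "UNIV = {F0, F1, F2, F3, F4}" by (auto intro: f5.exhaust)
  have "card (range residue) = card (UNIV :: f5 set)"
    by (rule card_image) (simp add: inj_def residue_inj)
  also have "\<dots> = CARD(5)" unfolding U by simp
  finally have "card (range residue) = CARD(5)" .
  then have "range residue = UNIV" by (intro card_subset_eq) auto
  then show ?thesis by (metis rangeE UNIV_I)
qed

fun matrix_of :: "mat \<Rightarrow> 5^2^2" where
  "matrix_of (M a b c d) = (\<chi> i j. residue (if i = 1 then (if j = 1 then a else b) else (if j = 1 then c else d)))"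

lemma matrix_of_mult: "matrix_of (x * y) = matrix_of x ** matrix_of y"
  by (cases x; cases y)
     (simp add: vec_eq_iff forall_2 matrix_matrix_mult_def sum_2 residue_hom)

lemma matrix_of_one: "matrix_of 1 = mat 1"
  by (simp add: one_mat_def vec_eq_iff forall_2 mat_def)

lemma det_matrix_of: "det (matrix_of x) = residue (dt x)"
  by (cases x) (simp add: det_2 residue_hom)

lemma matrix_of_inj: "matrix_of x = matrix_of y \<longleftrightarrow> x = y"
  by (cases x; cases y) (auto simp: vec_eq_iff forall_2 residue_inj)

lemma matrix_of_surj: "\<exists>x. matrix_of x = A"
proof -
  obtain a b c d where "residue a = A$1$1" "residue b = A$1$2" "residue c = A$2$1" "residue d = A$2$2"
    using residue_surj by metis
  then have "matrix_of (M a b c d) = A" by (simp add: vec_eq_iff forall_2)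
  then show ?thesis ..
qed

lemma carrier_SL25: "carrier SL25 = matrix_of ` SLm"
proof -
  have iff: "matrix_of x \<in> carrier SL25 \<longleftrightarrow> x \<in> SLm" for x
    using residue_inj[of "dt x" 1] by (simp add: SL_def SLm_def det_matrix_of)
  have "A \<in> carrier SL25 \<longleftrightarrow> A \<in> matrix_of ` SLm" for A
  proof -
    obtain x where "A = matrix_of x" using matrix_of_surj by metis
    then show ?thesis using iff matrix_of_inj by (simp add: image_iff)
  qed
  then show ?thesis by blast
qed

lemma matrix_of_in_carrier: "matrix_of x \<in> carrier SL25 \<longleftrightarrow> x \<in> SLm"
  unfolding carrier_SL25 using matrix_of_inj by auto

lemma inv_matrix_of: "x \<in> SLm \<Longrightarrow> inv\<^bsub>SL25\<^esub> (matrix_of x) = matrix_of (adj x)"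
  by (rule group.inv_equality[OF group_SL2])
     (simp_all add: matrix_of_in_carrier, simp_all add: SL_def matrix_of_mult[symmetric] matrix_of_one)

lemma card_matrix_of: "card (matrix_of ` X) = card X"
  by (rule card_image) (simp add: inj_on_def matrix_of_inj)

lemma cube_matrix_of: "cube SL25 (matrix_of ` X) = matrix_of ` cub X"
proof -
  have m: "A \<otimes>\<^bsub>SL25\<^esub> B = A ** B" for A B by (simp add: SL_def)
  show ?thesis
  proof (intro equalityI subsetI)
    fix A assume "A \<in> cube SL25 (matrix_of ` X)"
    then obtain a b c where "a \<in> X" "b \<in> X" "c \<in> X" "A = matrix_of (a * b * c)"
      unfolding cube_eq m by (auto simp: matrix_of_mult)
    then show "A \<in> matrix_of ` cub X" by (auto intro!: imageI cubI)
  next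
    fix A assume "A \<in> matrix_of ` cub X"
    then obtain a b c where "a \<in> X" "b \<in> X" "c \<in> X" "A = matrix_of a ** matrix_of b ** matrix_of c"
      unfolding cub_def by (auto simp: matrix_of_mult)
    then show "A \<in> cube SL25 (matrix_of ` X)" unfolding cube_eq m by blast
  qed
qed

lemma set_inv_matrix_of: "X \<subseteq> SLm \<Longrightarrow> set_inv\<^bsub>SL25\<^esub> (matrix_of ` X) = matrix_of ` adj ` X"
  unfolding SET_INV_def by (auto simp: inv_matrix_of subset_iff)

text \<open>
  Removing central elements does no harm, as \<open>spans\<close> provides them.
\<close>

lemma generate_imp_spans:
  assumes X: "X \<subseteq> SLm" "symm X" and gen: "generate SL25 (matrix_of ` X) = carrier SL25"
  shows "spans (X - {1, neg1})"
  unfolding spans_def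
proof (intro allI impI)
  fix H assume H: "X - {1, neg1} \<subseteq> H" "1 \<in> H" "neg1 \<in> H" "\<forall>x\<in>H. \<forall>y\<in>H. x * y \<in> H"
  have "A \<in> matrix_of ` H" if "A \<in> generate SL25 (matrix_of ` X)" for A
    using that
  proof induction
    case one
    then show ?case using H(2) matrix_of_one by (auto simp: SL_def intro!: image_eqI[of _ _ 1])
  next
    case (incl A)
    then show ?case using H by auto
  next
    case (inv A)
    then obtain x where x: "A = matrix_of x" "x \<in> X" by auto
    then have "inv\<^bsub>SL25\<^esub> A = matrix_of (adj x)" "adj x \<in> X"
      using X by (auto simp: inv_matrix_of symm_def)
    then show ?case using H by auto
  next
    case (eng A B)
    then obtain x y where "A = matrix_of x" "B = matrix_of y" "x \<in> H" "y \<in> H" by auto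
    then show ?case using H(4) by (auto simp: SL_def matrix_of_mult[symmetric])
  qed
  then have "matrix_of ` SLm \<subseteq> matrix_of ` H" using gen carrier_SL25 by auto
  then show "SLm \<subseteq> H" using matrix_of_inj by (auto simp: image_subset_iff)
qed

text \<open>
  The translation of \<open>not_slow\<close>. The number \<open>h\<close> of pairs is at most
  \<open>14\<close> because no elements may be missing beyond that.
\<close>

lemma cube_size:
  assumes S: "admissible SL25 S"
  obtains h where "1 \<le> h" "h \<le> 14" "2 \<le> card S" "card S \<le> 2 * h + 2" "120 - slack h \<le> card (cube SL25 S)"
proof -
  define X where "X = {x. matrix_of x \<in> S}"
  have S_eq: "S = matrix_of ` X"
  proof (intro equalityI subsetI)
    fix A assume "A \<in> S"
    moreover obtain x where "matrix_of x = A" using matrix_of_surj by metis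
    ultimately show "A \<in> matrix_of ` X" by (auto simp: X_def)
  qed (auto simp: X_def)
  have X: "X \<subseteq> SLm" using S matrix_of_in_carrier by (auto simp: X_def admissible_def)
  have one: "1 \<in> X" using S by (simp add: X_def admissible_def matrix_of_one) (simp add: SL_def)
  have "matrix_of ` X = matrix_of ` adj ` X"
    using S set_inv_matrix_of[OF X] unfolding admissible_def S_eq by simp
  then have "X = adj ` X"
    using inj_image_eq_iff[of matrix_of X "adj ` X"] by (simp add: inj_def matrix_of_inj)
  then have symX: "symm X" unfolding symm_def by blast
  define T where "T = X - {1, neg1}"
  have T: "symm T" "T \<subseteq> SLm - {1, neg1}"
  proof -
    have "adj x \<noteq> 1" "adj x \<noteq> neg1" if "x \<noteq> 1" "x \<noteq> neg1" for x
      using that by (metis adj_adj adj_one, metis adj_adj adj_neg1)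
    then show "symm T" using symX by (auto simp: T_def symm_def)
    show "T \<subseteq> SLm - {1, neg1}" using X by (auto simp: T_def)
  qed
  have "spans T"
    unfolding T_def using S S_eq by (intro generate_imp_spans X symX) (simp add: admissible_def)
  then have miss: "card (missing T) \<le> slack (pairs T)"
    using not_slow[of T] T by (simp add: slow_def)
  have finX: "finite X" using X finite_SLm finite_subset by blast
  have "cub (insert 1 T) \<subseteq> cub X" by (rule cub_mono) (use one in \<open>auto simp: T_def\<close>)
  moreover have cubX: "cub X \<subseteq> SLm" by (rule cub_subset_SLm[OF X])
  ultimately have "card (cub (insert 1 T)) \<le> card (cub X)"
    by (intro card_mono finite_subset[OF cubX finite_SLm])
  moreover have "T \<subseteq> SLm" using T by blast
  ultimately have cube: "120 - slack (pairs T) \<le> card (cube SL25 S)"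
    using miss card_missing[of T] by (simp add: S_eq cube_matrix_of card_matrix_of)
  have "T \<noteq> {}" using \<open>spans T\<close> not_spans_empty by blast
  then have Tpos: "0 < card T" using finX by (simp add: T_def card_gt_0_iff)
  have "card X \<le> card (T \<union> {1, neg1})" using finX by (intro card_mono) (auto simp: T_def)
  also have "\<dots> \<le> card T + card {1, neg1}" by (rule card_Un_le)
  also have "\<dots> \<le> card T + 2" using card_length[of "[1, neg1]"] by simp
  finally have cardX: "card X \<le> card T + 2" .
  have "Suc (card T) = card (insert 1 T)" using finX by (simp add: T_def)
  also have "\<dots> \<le> card X" using finX one by (intro card_mono) (auto simp: T_def)
  finally have "2 \<le> card S" using Tpos by (simp add: S_eq card_matrix_of)
  moreover have "card S \<le> 2 * pairs T + 2" using cardX by (simp add: S_eq card_matrix_of pairs_def)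
  moreover have "1 \<le> pairs T" using Tpos by (simp add: pairs_def)
  moreover have "pairs T \<le> 14"
  proof (rule ccontr)
    assume "\<not> pairs T \<le> 14"
    then have "slack (pairs T) \<le> slack 15" by (intro antimonoD[OF antimono_slack]) simp
    also have "slack 15 = 0" by code_simp
    finally have "120 \<le> card (cub X)" using cube by (simp add: S_eq cube_matrix_of card_matrix_of)
    then have "cub X = SLm" using cubX card_SLm by (intro card_seteq) auto
    then have "cube SL25 S = carrier SL25" by (simp add: S_eq cube_matrix_of carrier_SL25)
    then show False using S by (simp add: admissible_def)
  qed
  ultimately show thesis using that cube by blast
qed

lemma powr_le_of_power_le:
  assumes "x ^ p \<le> y ^ q" "0 < q" "0 < x" "0 \<le> y" shows "x powr (real p / real q) \<le> (y::real)"
proof (rule power_le_imp_le_base)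
  have "(x powr (real p / real q)) ^ q = x powr real p"
    using assms by (simp add: powr_realpow[symmetric] powr_powr)
  also have "\<dots> = x ^ p" using assms by (simp add: powr_realpow)
  also have "\<dots> \<le> y ^ q" by (rule assms(1))
  finally show "(x powr (real p / real q)) ^ Suc (q - 1) \<le> y ^ Suc (q - 1)" using assms(2) by simp
qed (rule assms)

text \<open>
  After division by \<open>30 ^ 400\<close> the claim is \<open>30 ^ 157 \<le> 3.8 ^
  400\<close>. The fractions \<open>28 / 11\<close> and \<open>51 / 20\<close> are neighbouring
  approximations of \<open>400 / 157\<close> from both sides, and the claim is the product of
  the seventh and the fourth power of estimates for \<open>3.8 ^ 28\<close> and \<open>3.8 ^
  51\<close>. This avoids numbers with hundreds of digits.
\<close>

lemma power_30_114: "(30::real) ^ 557 \<le> 114 ^ 400"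
proof -
  have a: "967 / 1000 * 30 ^ 11 \<le> (38 / 10 :: real) ^ 28" by (simp add: power_divide)
  have b: "10629 / 10000 * 30 ^ 20 \<le> (38 / 10 :: real) ^ 51" by (simp add: power_divide)
  have c: "1 \<le> (967 / 1000 :: real) ^ 7 * (10629 / 10000) ^ 4" by (simp add: power_divide)
  have e: "11 * 7 + 20 * 4 = (157::nat)" "28 * 7 + 51 * 4 = (400::nat)" "400 + 157 = (557::nat)"
    and m: "30 * (38 / 10) = (114::real)" by simp_all
  have p: "(30::real) ^ 157 = (30 ^ 11) ^ 7 * (30 ^ 20) ^ 4"
    by (simp only: power_mult[symmetric] power_add[symmetric] e)
  have "1 * (30::real) ^ 157 \<le> ((967 / 1000) ^ 7 * (10629 / 10000) ^ 4) * 30 ^ 157"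
    by (intro mult_right_mono c zero_le_power) simp
  also have "\<dots> = (967 / 1000 * 30 ^ 11) ^ 7 * (10629 / 10000 * 30 ^ 20) ^ 4"
    by (simp only: p power_mult_distrib ac_simps)
  also have "\<dots> \<le> ((38 / 10) ^ 28) ^ 7 * ((38 / 10) ^ 51) ^ 4"
    by (intro mult_mono power_mono a b zero_le_power mult_nonneg_nonneg) simp_all
  also have "\<dots> = (38 / 10 :: real) ^ 400"
    by (simp only: power_mult[symmetric] power_add[symmetric] e)
  finally have "(30::real) ^ 400 * (1 * 30 ^ 157) \<le> 30 ^ 400 * (38 / 10) ^ 400"
    by (intro mult_left_mono zero_le_power) simp_all
  then show ?thesis
    by (simp only: mult_1_left power_add[symmetric] power_mult_distrib[symmetric] e m)
qed

lemma h_cases: "1 \<le> h \<Longrightarrow> h \<le> (14::nat) \<Longrightarrow> h \<in> {1,2,3,4,5,6,7,8,9,10,11,12,13,14}"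
  unfolding insert_iff empty_iff by presburger

lemma slack_values:
  "slack 1 = 113" "slack 2 = 107" "slack 3 = 101" "slack 4 = 95" "slack 5 = 88" "slack 6 = 80" "slack 7 = 72"
  "slack 8 = 64" "slack 9 = 55" "slack 10 = 45" "slack 11 = 36" "slack 12 = 26" "slack 13 = 16" "slack 14 = 6"
  by code_simp+

text \<open>
  The fraction \<open>149 / 107\<close> lies strictly above \<open>ln 114 / ln 30\<close>, and
  below the exponents for all other sizes. The closest of these is \<open>ln 56 / ln 18\<close>,
  at \<open>h = 8\<close>; for the others the simpler fraction \<open>39 / 28\<close> suffices.
\<close>

lemma slack_power:
  assumes "1 \<le> h" "h < 14"
  obtains p q where "149 * q \<le> 107 * p" "0 < q" "(2 * h + 2) ^ p < (120 - slack h) ^ q"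
proof (cases "h = 8")
  case True
  have "(18::nat) ^ 149 < 56 ^ 107" by simp
  then show thesis using that[of 107 149] True by (simp add: slack_values)
next
  case False
  have "h \<in> {1,2,3,4,5,6,7,8,9,10,11,12,13,14}" using assms by (intro h_cases) auto
  then have "(2 * h + 2) ^ 39 < (120 - slack h) ^ 28"
    using assms(2) False unfolding insert_iff empty_iff by (elim disjE; simp add: slack_values slack_values(1)[unfolded One_nat_def])
  then show thesis using that[of 28 39] by simp
qed

lemma ln_less_of_power_less:
  assumes "k ^ p < t ^ q" "0 < k" "0 < t" shows "real p * ln (real k) < real q * ln (real t)"
proof -
  have "real (k ^ p) < real (t ^ q)" using assms(1) by (simp only: of_nat_less_iff)
  then have "ln (real (k ^ p)) < ln (real (t ^ q))"
    by (rule ln_less_cancel_iff[THEN iffD2, rotated -1]) (use assms in simp_all)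
  then show ?thesis using assms by (simp add: ln_realpow)
qed

lemma growth_exponent_bound:
  assumes S: "admissible SL25 S"
  shows "real (card S) powr 1.3925 \<le> real (card (cube SL25 S))"
    and "ln 114 / ln 30 \<le> growth_exponent SL25 S"
    and "growth_exponent SL25 S = ln 114 / ln 30 \<Longrightarrow> card S = 30 \<and> card (cube SL25 S) = 114"
proof -
  obtain h where h: "1 \<le> h" "h \<le> 14" and k: "2 \<le> card S" "card S \<le> 2 * h + 2"
    and c: "120 - slack h \<le> card (cube SL25 S)"
    using cube_size[OF S] by blast
  let ?k = "card S" and ?c = "card (cube SL25 S)"
  have lnk: "0 < ln (real ?k)" using k by simp
  have "real ?k powr 1.3925 \<le> real ?c \<and> ln 114 / ln 30 \<le> growth_exponent SL25 S \<and>
    (growth_exponent SL25 S = ln 114 / ln 30 \<longrightarrow> ?k = 30 \<and> ?c = 114)"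
  proof (cases "h = 14")
    case True
    then have kc: "?k \<le> 30" "114 \<le> ?c" using k c by (auto simp: slack_values)
    then have c0: "0 < ?c" by linarith
    have "real ?k powr (real 557 / real 400) \<le> real ?c"
    proof (rule powr_le_of_power_le)
      have "real ?k ^ 557 \<le> 30 ^ 557" using kc by (intro power_mono) auto
      also have "\<dots> \<le> 114 ^ 400" by (rule power_30_114)
      also have "\<dots> \<le> real ?c ^ 400" using kc by (intro power_mono) auto
      finally show "real ?k ^ 557 \<le> real ?c ^ 400" .
    qed (use k in auto)
    then have powr: "real ?k powr 1.3925 \<le> real ?c" by simp
    have ln: "ln (real ?k) \<le> ln 30" "ln 114 \<le> ln (real ?c)" using kc k c0 by simp_all
    have "?k = 30 \<and> ?c = 114" if "growth_exponent SL25 S = ln 114 / ln 30"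
    proof -
      have eq: "ln (real ?c) * ln 30 = ln 114 * ln (real ?k)"
        using that lnk by (simp add: growth_exponent_def field_simps)
      have "ln 114 * ln (real ?k) \<le> ln 114 * ln 30" using ln by (intro mult_left_mono) auto
      moreover have "ln 114 * ln 30 \<le> ln (real ?c) * ln 30" using ln by (intro mult_right_mono) auto
      ultimately have "ln 114 * ln (real ?k) = ln 114 * ln 30" "ln (real ?c) * ln 30 = ln 114 * ln 30"
        using eq by linarith+
      then have "ln (real ?k) = ln 30" "ln (real ?c) = ln 114" by simp_all
      then have "real ?k = 30" "real ?c = 114" using k c0 by (simp_all add: ln_inj_iff)
      then show ?thesis by linarith
    qed
    moreover have "ln 114 / ln 30 \<le> ln (real ?c) / ln (real ?k)"
      using ln lnk by (intro frac_le) (auto intro: order_trans[of _ "ln 114"])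
    ultimately show ?thesis using powr by (simp add: growth_exponent_def)
  next
    case False
    then have "h < 14" using h by simp
    then obtain p q where pq: "149 * q \<le> 107 * p" "0 < q" "(2 * h + 2) ^ p < (120 - slack h) ^ q"
      using slack_power[OF h(1)] by blast
    have "?k ^ p \<le> (2 * h + 2) ^ p" using k by (intro power_mono) auto
    also note pq(3)
    also have "(120 - slack h) ^ q \<le> ?c ^ q" using c by (intro power_mono) auto
    finally have less: "?k ^ p < ?c ^ q" .
    have c0: "0 < ?c"
    proof (rule ccontr)
      assume "\<not> 0 < ?c"
      then have "?k ^ p < 0 ^ q" using less by (simp only: not_gr_zero)
      then show False using pq(2) by (simp add: zero_power)
    qed
    have "real (149 * q) \<le> real (107 * p)" using pq(1) by (simp only: of_nat_le_iff)
    then have ratio: "149 / 107 \<le> real p / real q" using pq(2) by (simp add: field_simps)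
    have "real ?k powr 1.3925 \<le> real ?k powr (real p / real q)"
      using ratio k by (intro powr_mono) auto
    also have "\<dots> \<le> real ?c"
      using less k pq(2) by (intro powr_le_of_power_le)
        (auto simp flip: of_nat_power simp del: of_nat_power_less_of_nat_cancel_iff)
    finally have powr: "real ?k powr 1.3925 \<le> real ?c" .
    have "real p * ln (real ?k) < real q * ln (real ?c)"
      using ln_less_of_power_less[OF less] k c0 by simp
    then have "real p / real q < growth_exponent SL25 S"
      using lnk pq(2) by (simp add: growth_exponent_def field_simps)
    with ratio have "149 / 107 < growth_exponent SL25 S" by linarith
    moreover have "(114::nat) ^ 107 < 30 ^ 149" by simp
    then have "107 * ln 114 < 149 * ln (30::real)"
      using ln_less_of_power_less[of 114 107 30 149] by simp
    then have "ln 114 / ln 30 < (149 / 107 :: real)" by (simp add: field_simps)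
    ultimately show ?thesis using powr by linarith
  qed
  then show "real ?k powr 1.3925 \<le> real ?c" "ln 114 / ln 30 \<le> growth_exponent SL25 S"
    "growth_exponent SL25 S = ln 114 / ln 30 \<Longrightarrow> ?k = 30 \<and> ?c = 114" by blast+
qed

text \<open>
  One of the sets of fourteen pairs that avoid an element of order \<open>4\<close>, together
  with the centre.
\<close>

definition example :: "mat list" where
  "example = [
   M F1 F0 F0 F1, M F0 F1 F4 F1, M F0 F1 F4 F3, M F0 F2 F2 F3, M F0 F3 F3 F2, M F0 F4 F1 F2,
   M F0 F4 F1 F4, M F1 F0 F2 F1, M F1 F0 F3 F1, M F1 F2 F1 F3, M F1 F2 F3 F2, M F1 F4 F1 F0,
   M F2 F1 F0 F3, M F2 F1 F4 F0, M F2 F2 F0 F3, M F2 F2 F1 F4, M F2 F2 F2 F0, M F2 F3 F2 F1,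
   M F3 F2 F3 F4, M F3 F3 F0 F2, M F3 F3 F3 F0, M F3 F3 F4 F1, M F3 F4 F0 F2, M F3 F4 F1 F0,
   M F4 F0 F0 F4, M F4 F0 F2 F4, M F4 F0 F3 F4, M F4 F1 F4 F0, M F4 F3 F2 F3, M F4 F3 F4 F2]"

text \<open>
  The six elements that the cube of the example misses.
\<close>

definition omitted :: "mat list" where
  "omitted = [
   M F1 F3 F1 F4, M F2 F0 F2 F3, M F2 F4 F0 F3, M F3 F0 F3 F2, M F3 F1 F0 F2, M F4 F2 F4 F1]"

lemma symm_sq: "symm V \<Longrightarrow> symm (sq V)"
  unfolding symm_def
proof (rule ballI)
  fix x assume V: "\<forall>x\<in>V. adj x \<in> V" and "x \<in> sq V"
  then obtain a b where "a \<in> V" "b \<in> V" "x = a * b" by (auto simp: sq_def)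
  then have "adj b \<in> V" "adj a \<in> V" "adj x = adj b * adj a" using V by (simp_all add: adj_mult)
  then show "adj x \<in> sq V" unfolding sq_def by blast
qed

lemma set_all_squares:
  "symm W \<Longrightarrow> set S \<subseteq> W \<Longrightarrow> set xs \<subseteq> W \<Longrightarrow> set (fst P) \<subseteq> sq W \<Longrightarrow>
    set (fst (all_squares S xs P)) \<subseteq> sq W"
proof (induction xs arbitrary: P)
  case (Cons x xs)
  then have "set (fst (squares x S P)) \<subseteq> sq W" by (intro set_squares) auto
  then show ?case using Cons by simp
qed simp

lemma example_facts:
  "list_all (\<lambda>x. dt x = 1 \<and> adj x \<in> set example) example" "1 \<in> set example" "distinct example"
  "list_all (\<lambda>x. dt x = 1) omitted" "distinct omitted"
  "list_all (\<lambda>x. list_all (\<lambda>a. list_all (\<lambda>b. \<not> mem (adj a * x * adj b) (inss example Empty)) example) example) omitted"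
  by code_simp+

text \<open>
  Every group element is a product of four elements of the example.
\<close>

lemma example_generates:
  "let P = fst (all_squares example example ([], Empty)) in
    all_in (inss (fst (all_squares P P ([], Empty))) Empty) sl"
  by code_simp

lemma example_admissible: "admissible SL25 (matrix_of ` set example)"
  and card_example: "card (matrix_of ` set example) = 30"
  and card_cube_example: "card (cube SL25 (matrix_of ` set example)) = 114"
proof -
  let ?W = "set example" and ?S = "matrix_of ` set example"
  have W: "?W \<subseteq> SLm" "symm ?W" and X: "set omitted \<subseteq> SLm"
    using example_facts(1,4) by (auto simp: list_all_iff SLm_def symm_def)
  have "length example = 30" "length omitted = 6" by (simp_all add: example_def omitted_def)
  then have card: "card ?W = 30" "card (set omitted) = 6"
    using example_facts(3,5) by (simp_all add: distinct_card)
  then show cardS: "card ?S = 30" by (simp add: card_matrix_of)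
  have "a * b * c \<notin> set omitted" if "a \<in> ?W" "b \<in> ?W" "c \<in> ?W" for a b c
  proof
    assume "a * b * c \<in> set omitted"
    then have "\<not> mem (adj a * (a * b * c) * adj c) (inss example Empty)"
      using example_facts(6) that unfolding list_all_iff by blast
    moreover have "adj a * (a * b * c) * adj c = b"
      using that W(1) by (simp add: mult.assoc subset_iff)
    moreover have "b \<in> elems (inss example Empty)" using that W(1) by simp
    ultimately show False by (auto simp: elems_def)
  qed
  then have "cub ?W \<inter> set omitted = {}" by (auto simp: cub_def)
  then have "cub ?W \<subseteq> SLm - set omitted" using cub_subset_SLm[OF W(1)] by blast
  then have "card (cub ?W) \<le> card (SLm - set omitted)" by (intro card_mono) auto
  also have "\<dots> = 114" using X by (simp add: card_Diff_subset card_SLm card)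
  finally have upper: "card (cube SL25 ?S) \<le> 114" by (simp add: cube_matrix_of card_matrix_of)
  have S_carrier: "?S \<subseteq> carrier SL25" using W(1) carrier_SL25 by blast
  have gen: "matrix_of x \<in> generate SL25 ?S" if "x \<in> SLm" for x
  proof -
    let ?P = "fst (all_squares example example ([], Empty))"
    have P: "set ?P \<subseteq> sq ?W" using W(2) by (intro set_all_squares) auto
    have sq: "symm (sq ?W)" by (rule symm_sq[OF W(2)])
    have sq_SLm: "sq ?W \<subseteq> SLm" using W(1) by (auto simp: sq_def subset_iff)
    have PP: "set (fst (all_squares ?P ?P ([], Empty))) \<subseteq> sq (sq ?W)"
      using set_all_squares[OF sq P P, of "([], Empty)"] by simp
    moreover have "sq (sq ?W) \<subseteq> SLm" using sq_SLm by (auto simp: sq_def[of "sq ?W"] subset_iff)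
    ultimately have "elems (inss (fst (all_squares ?P ?P ([], Empty))) Empty) \<subseteq> sq (sq ?W)"
      by (subst elems_inss) auto
    moreover have "x \<in> elems (inss (fst (all_squares ?P ?P ([], Empty))) Empty)"
      using example_generates that by (simp add: Let_def all_in_iff set_sl elems_def)
    ultimately obtain a b c d where x: "x = (a * b) * (c * d)" "a \<in> ?W" "b \<in> ?W" "c \<in> ?W" "d \<in> ?W"
      unfolding sq_def by blast
    have mult: "A \<in> generate SL25 ?S \<Longrightarrow> B \<in> generate SL25 ?S \<Longrightarrow> A ** B \<in> generate SL25 ?S" for A B
      using generate.eng[of A SL25 ?S B] by (simp add: SL_def)
    show ?thesis
      unfolding x(1) matrix_of_mult using x(2-5) by (intro mult generate.incl) auto
  qed
  have "generate SL25 ?S \<subseteq> carrier SL25"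
    using group.generate_incl[OF group_SL2 S_carrier] .
  moreover have "carrier SL25 \<subseteq> generate SL25 ?S"
    unfolding carrier_SL25 by (rule image_subsetI) (rule gen)
  ultimately have "generate SL25 ?S = carrier SL25"
    by (rule equalityI)
  moreover have "cube SL25 ?S \<noteq> carrier SL25"
    using upper card_SLm by (auto simp: carrier_SL25 card_matrix_of)
  moreover have "adj ` ?W = ?W"
  proof (intro equalityI subsetI)
    fix x assume "x \<in> ?W"
    then have "adj x \<in> ?W" using W(2) by (simp add: symm_def)
    then show "x \<in> adj ` ?W" by (rule image_eqI[rotated]) simp
  qed (use W(2) in \<open>auto simp: symm_def\<close>)
  then have "?S = set_inv\<^bsub>SL25\<^esub> ?S" using set_inv_matrix_of[OF W(1)] by simp
  moreover have "\<one>\<^bsub>SL25\<^esub> \<in> ?S"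
    using example_facts(2) matrix_of_one by (auto simp: SL_def intro!: image_eqI[of _ _ 1])
  ultimately show adm: "admissible SL25 ?S"
    using S_carrier by (simp add: admissible_def)
  obtain h where "h \<le> 14" "card ?S \<le> 2 * h + 2" "120 - slack h \<le> card (cube SL25 ?S)"
    using cube_size[OF adm] by blast
  moreover from this have "h = 14" using cardS by simp
  ultimately show "card (cube SL25 ?S) = 114"
    using upper by (simp add: slack_values)
qed

theorem theorem8p1:
  shows "(\<forall>S. admissible SL25 S \<longrightarrow>
             real (card (cube SL25 S)) \<ge> real (card S) powr 1.3925) \<and>
         (\<exists>S. is_arg_min (growth_exponent SL25) (admissible SL25) S) \<and>
         (\<forall>S. is_arg_min (growth_exponent SL25) (admissible SL25) S \<longrightarrow>
             card S = 30 \<and> card (cube SL25 S) = 114)"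
proof (intro conjI allI impI)
  let ?S = "matrix_of ` set example"
  have ex: "growth_exponent SL25 ?S = ln 114 / ln 30"
    by (simp add: growth_exponent_def card_example card_cube_example)
  show "\<exists>S. is_arg_min (growth_exponent SL25) (admissible SL25) S"
    using example_admissible growth_exponent_bound(2) ex unfolding is_arg_min_def
    by (intro exI[of _ ?S]) (auto simp: not_less)
  fix S assume "is_arg_min (growth_exponent SL25) (admissible SL25) S"
  then have "admissible SL25 S" "growth_exponent SL25 S \<le> ln 114 / ln 30"
    using example_admissible ex unfolding is_arg_min_def by (auto simp: not_less)
  then have "growth_exponent SL25 S = ln 114 / ln 30"
    using growth_exponent_bound(2)[of S] by linarith
  then show "card S = 30" "card (cube SL25 S) = 114"
    using growth_exponent_bound(3) \<open>admissible SL25 S\<close> by blast+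
qed (use growth_exponent_bound(1) in blast)

end
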